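(* Let $\varphi,\psi$ be propositional formulas in the signature $\{\wedge,\vee,\to,0,1\}$. Then $\varphi\vdash\psi$ is valid in all Heyting algebras and in all orthomodular algebras if and only if $\varphi\vdash\psi$ is valid in every fundamental algebra satisfying (for all elements $a,b,c,d,e,f,g$, with $\lnot x := x\to 0$) the following five axioms: 1. (iEx) $$\Big[\big(a\wedge((b\wedge c)\vee(b\wedge d))\big)\to g\Big]\wedge a\wedge(c\vee e)\wedge\lnot\lnot f\ \leq\ \lnot\lnot(a\wedge f)\wedge\big[(a\wedge c)\vee(a\wedge e)\vee f\big]\wedge\Big[(b\wedge(c\vee d))\vee\big((b\wedge(c\vee d))\to g\big)\Big];$$ 2. $\lnot(a\to b)=\lnot(\lnot a\vee(a\wedge b))$; 3. $a\wedge(a\to b)=a\wedge b$; 4. $(a\wedge b)\to b=1$; 5. $a\to(b\wedge c)\leq a\to b$. In other words, the joint validities of intuitionistic logic and orthomodular logic (with the Sasaki implication) in the full signature are axiomatized over fundamental logic with implication by these axioms.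
   Context: A fundamental algebra is a structure $(L,\wedge,\vee,0,1,\to)$ such that $(L,\wedge,\vee,0,1)$ is a bounded lattice, $\to$ is a binary operation, and, with $\lnot a:=a\to 0$, for all $a,b\in L$: (i) $a\leq b$ implies $\lnot b\leq\lnot a$; (ii) $a\wedge\lnot a=0$; (iii) $a\leq\lnot\lnot a$. An orthomodular algebra is a fundamental algebra such that for all $a,b$: $\lnot\lnot a=a$, $a\wedge(a\to b)\leq b$, and $a\to b=\lnot a\vee(a\wedge b)$ (the Sasaki implication). Orthomodular logic is the logic of orthomodular algebras. A Heyting algebra is a fundamental algebra satisfying, for all $a,b,c$: $c\wedge a\leq b$ iff $c\leq a\to b$. Intuitionistic logic is the logic of Heyting algebras. A valuation into a fundamental algebra $L$ assigns elements of $L$ to propositional variables and extends to all formulas by interpreting the connectives as the operations of $L$. $\varphi\vdash\psi$ is valid in $L$ if $v(\varphi)\leq v(\psi)$ for every valuation $v$ into $L$. *)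

theory Defs
  imports "HOL-Algebra.Lattice" "HOL-Library.Infinite_Typeclass"
begin

text \<open>
  Algebras are carrier-based, on top of the bounded lattices of HOL-Algebra. In those, meet, join,
  bottom and top are determined by the order, and equality is the actual equality.
  One-element algebras are allowed.
\<close>

record 'a imp_order = "'a gorder" +
  imp :: "'a \<Rightarrow> 'a \<Rightarrow> 'a"  (infixr \<open>\<leadsto>\<index>\<close> 60)

definition neg :: "('a, 'b) imp_order_scheme \<Rightarrow> 'a \<Rightarrow> 'a"  (\<open>\<sim>\<index>_\<close> [80] 80)
  where "\<sim>\<^bsub>L\<^esub> a = a \<leadsto>\<^bsub>L\<^esub> \<bottom>\<^bsub>L\<^esub>"

locale fundamental_algebra = bounded_lattice L for L (structure) +
  assumes imp_closed: "a \<in> carrier L \<Longrightarrow> b \<in> carrier L \<Longrightarrow> a \<leadsto> b \<in> carrier L"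
    and neg_antitone: "a \<in> carrier L \<Longrightarrow> b \<in> carrier L \<Longrightarrow> a \<sqsubseteq> b \<Longrightarrow> \<sim>b \<sqsubseteq> \<sim>a"
    and meet_neg: "a \<in> carrier L \<Longrightarrow> a \<sqinter> \<sim>a = \<bottom>"
    and le_neg_neg: "a \<in> carrier L \<Longrightarrow> a \<sqsubseteq> \<sim>\<sim>a"

locale orthomodular_algebra = fundamental_algebra +
  assumes neg_neg: "a \<in> carrier L \<Longrightarrow> \<sim>\<sim>a = a"
    and modus_ponens: "a \<in> carrier L \<Longrightarrow> b \<in> carrier L \<Longrightarrow> a \<sqinter> (a \<leadsto> b) \<sqsubseteq> b"
    and sasaki: "a \<in> carrier L \<Longrightarrow> b \<in> carrier L \<Longrightarrow> a \<leadsto> b = \<sim>a \<squnion> (a \<sqinter> b)"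

locale heyting_algebra = fundamental_algebra +
  assumes residuation: "a \<in> carrier L \<Longrightarrow> b \<in> carrier L \<Longrightarrow> c \<in> carrier L \<Longrightarrow>
    c \<sqinter> a \<sqsubseteq> b \<longleftrightarrow> c \<sqsubseteq> a \<leadsto> b"

locale iEx_algebra = fundamental_algebra +
  assumes iEx: "\<lbrakk>a \<in> carrier L; b \<in> carrier L; c \<in> carrier L; d \<in> carrier L;
      e \<in> carrier L; f \<in> carrier L; g \<in> carrier L\<rbrakk> \<Longrightarrow>
      ((a \<sqinter> ((b \<sqinter> c) \<squnion> (b \<sqinter> d))) \<leadsto> g) \<sqinter> a \<sqinter> (c \<squnion> e) \<sqinter> \<sim>\<sim>f
      \<sqsubseteq> \<sim>\<sim>(a \<sqinter> f) \<sqinter> ((a \<sqinter> c) \<squnion> (a \<sqinter> e) \<squnion> f)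
          \<sqinter> ((b \<sqinter> (c \<squnion> d)) \<squnion> ((b \<sqinter> (c \<squnion> d)) \<leadsto> g))"
    and neg_imp: "a \<in> carrier L \<Longrightarrow> b \<in> carrier L \<Longrightarrow> \<sim>(a \<leadsto> b) = \<sim>(\<sim>a \<squnion> (a \<sqinter> b))"
    and meet_imp: "a \<in> carrier L \<Longrightarrow> b \<in> carrier L \<Longrightarrow> a \<sqinter> (a \<leadsto> b) = a \<sqinter> b"
    and imp_weaken: "a \<in> carrier L \<Longrightarrow> b \<in> carrier L \<Longrightarrow> (a \<sqinter> b) \<leadsto> b = \<top>"
    and imp_meet_le: "a \<in> carrier L \<Longrightarrow> b \<in> carrier L \<Longrightarrow> c \<in> carrier L \<Longrightarrow>
      a \<leadsto> (b \<sqinter> c) \<sqsubseteq> a \<leadsto> b"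

datatype 'v form =
    Var 'v
  | Zero
  | One
  | And "'v form" "'v form"
  | Or "'v form" "'v form"
  | Imp "'v form" "'v form"

primrec eval :: "('a, 'b) imp_order_scheme \<Rightarrow> ('v \<Rightarrow> 'a) \<Rightarrow> 'v form \<Rightarrow> 'a" where
  "eval L v (Var p) = v p"
| "eval L v Zero = \<bottom>\<^bsub>L\<^esub>"
| "eval L v One = \<top>\<^bsub>L\<^esub>"
| "eval L v (And \<phi> \<psi>) = eval L v \<phi> \<sqinter>\<^bsub>L\<^esub> eval L v \<psi>"
| "eval L v (Or \<phi> \<psi>) = eval L v \<phi> \<squnion>\<^bsub>L\<^esub> eval L v \<psi>"
| "eval L v (Imp \<phi> \<psi>) = eval L v \<phi> \<leadsto>\<^bsub>L\<^esub> eval L v \<psi>"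

definition valid_in :: "('a, 'b) imp_order_scheme \<Rightarrow> 'v form \<Rightarrow> 'v form \<Rightarrow> bool" where
  "valid_in L \<phi> \<psi> \<longleftrightarrow> (\<forall>v \<in> UNIV \<rightarrow> carrier L. eval L v \<phi> \<sqsubseteq>\<^bsub>L\<^esub> eval L v \<psi>)"

text \<open>
  A class of algebras cannot be quantified over across all types inside a formula. Validity in
  all algebras of a class is therefore stated for all algebras whose carrier is a subset of a
  given infinite type. The choice of that type is immaterial: the classes above are closed under
  subalgebras and isomorphic copies, and a refuting valuation lives in the countable subalgebra
  generated by its values on the finitely many variables of the two formulas.
\<close>

definition heyting_valid :: "'a::infinite itself \<Rightarrow> 'v form \<Rightarrow> 'v form \<Rightarrow> bool" where
  "heyting_valid _ \<phi> \<psi> \<longleftrightarrow> (\<forall>L :: 'a imp_order. heyting_algebra L \<longrightarrow> valid_in L \<phi> \<psi>)"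

definition orthomodular_valid :: "'a::infinite itself \<Rightarrow> 'v form \<Rightarrow> 'v form \<Rightarrow> bool" where
  "orthomodular_valid _ \<phi> \<psi> \<longleftrightarrow> (\<forall>L :: 'a imp_order. orthomodular_algebra L \<longrightarrow> valid_in L \<phi> \<psi>)"

definition iEx_valid :: "'a::infinite itself \<Rightarrow> 'v form \<Rightarrow> 'v form \<Rightarrow> bool" where
  "iEx_valid _ \<phi> \<psi> \<longleftrightarrow> (\<forall>L :: 'a imp_order. iEx_algebra L \<longrightarrow> valid_in L \<phi> \<psi>)"

end

theory Submission
  imports Defs "HOL-Library.Countable_Set"
begin

text \<open>
  Let \<open>L\<close> satisfy the five axioms and let a valuation give \<open>\<phi>\<close>, \<open>\<psi>\<close> the values \<open>p\<close>, \<open>q\<close> with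
  \<open>p \<sqsubseteq> q\<close> failing. The regular elements (\<open>\<sim>\<sim>a = a\<close>) form an orthomodular algebra of which \<open>a \<mapsto> \<sim>\<sim>a\<close>
  is a homomorphism, so it refutes the sequent if \<open>\<sim>\<sim>p \<sqsubseteq> \<sim>\<sim>q\<close> fails. Otherwise \<open>p \<sqsubseteq> \<sim>\<sim>q\<close>, and
  below \<open>\<sim>\<sim>q\<close> the axiom iEx gives enough distributivity modulo \<open>q\<close> for a maximal filter containing \<open>p\<close>
  and avoiding \<open>q\<close> to be prime. The third conjunct of iEx makes \<open>a \<mapsto> {F prime. a \<in> F}\<close> commute with
  implication, even though \<open>L\<close> need not be distributive; it is therefore a homomorphism into the
  Heyting algebra of upsets of prime filters, which refutes the sequent.
\<close>

section \<open>Lattices with prescribed operations\<close>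

text \<open>Meets, joins and bounds in HOL-Algebra are determined by the order. For a concrete
  structure this locale reduces the lattice laws to the universal properties of candidate
  operations, and then identifies the abstract operations with them.\<close>

locale presented_lattice =
  fixes L (structure) and m j :: "'a \<Rightarrow> 'a \<Rightarrow> 'a" and b t :: 'a
  assumes eq_eq: "eq L = (=)"
    and ord_refl: "x \<in> carrier L \<Longrightarrow> x \<sqsubseteq> x"
    and ord_antisym: "\<lbrakk>x \<in> carrier L; y \<in> carrier L; x \<sqsubseteq> y; y \<sqsubseteq> x\<rbrakk> \<Longrightarrow> x = y"
    and ord_trans: "\<lbrakk>x \<in> carrier L; y \<in> carrier L; z \<in> carrier L; x \<sqsubseteq> y; y \<sqsubseteq> z\<rbrakk> \<Longrightarrow> x \<sqsubseteq> z"
    and m_closed: "\<lbrakk>x \<in> carrier L; y \<in> carrier L\<rbrakk> \<Longrightarrow> m x y \<in> carrier L"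
    and m_left: "\<lbrakk>x \<in> carrier L; y \<in> carrier L\<rbrakk> \<Longrightarrow> m x y \<sqsubseteq> x"
    and m_right: "\<lbrakk>x \<in> carrier L; y \<in> carrier L\<rbrakk> \<Longrightarrow> m x y \<sqsubseteq> y"
    and m_greatest: "\<lbrakk>x \<in> carrier L; y \<in> carrier L; z \<in> carrier L; z \<sqsubseteq> x; z \<sqsubseteq> y\<rbrakk> \<Longrightarrow> z \<sqsubseteq> m x y"
    and j_closed: "\<lbrakk>x \<in> carrier L; y \<in> carrier L\<rbrakk> \<Longrightarrow> j x y \<in> carrier L"
    and j_left: "\<lbrakk>x \<in> carrier L; y \<in> carrier L\<rbrakk> \<Longrightarrow> x \<sqsubseteq> j x y"
    and j_right: "\<lbrakk>x \<in> carrier L; y \<in> carrier L\<rbrakk> \<Longrightarrow> y \<sqsubseteq> j x y"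
    and j_least: "\<lbrakk>x \<in> carrier L; y \<in> carrier L; z \<in> carrier L; x \<sqsubseteq> z; y \<sqsubseteq> z\<rbrakk> \<Longrightarrow> j x y \<sqsubseteq> z"
    and b_closed: "b \<in> carrier L" and b_least: "x \<in> carrier L \<Longrightarrow> b \<sqsubseteq> x"
    and t_closed: "t \<in> carrier L" and t_greatest: "x \<in> carrier L \<Longrightarrow> x \<sqsubseteq> t"
begin

lemma bounded_lattice: "bounded_lattice L"
proof -
  have inf: "greatest L (m x y) (Lower L {x, y})" if "x \<in> carrier L" "y \<in> carrier L" for x y
    using that by (auto simp: greatest_def Lower_def m_closed m_left m_right m_greatest)
  have sup: "least L (j x y) (Upper L {x, y})" if "x \<in> carrier L" "y \<in> carrier L" for x y
    using that by (auto simp: least_def Upper_def j_closed j_left j_right j_least)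
  have "least L b (carrier L)" "greatest L t (carrier L)"
    by (auto simp: least_def greatest_def b_closed b_least t_closed t_greatest)
  then show ?thesis
    by unfold_locales (auto simp: eq_eq ord_refl intro: ord_antisym ord_trans inf sup)
qed

sublocale bounded_lattice L
  by (rule bounded_lattice)

lemma meet_eq: "\<lbrakk>x \<in> carrier L; y \<in> carrier L\<rbrakk> \<Longrightarrow> x \<sqinter> y = m x y"
  by (intro ord_antisym m_greatest meet_le)
    (auto simp: m_closed m_left m_right meet_left meet_right)

lemma join_eq: "\<lbrakk>x \<in> carrier L; y \<in> carrier L\<rbrakk> \<Longrightarrow> x \<squnion> y = j x y"
  by (intro ord_antisym j_least join_le)
    (auto simp: j_closed j_left j_right join_left join_right)

lemma bot_eq: "\<bottom> = b"
  by (intro ord_antisym) (auto simp: b_closed b_least)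

lemma top_eq': "\<top> = t"
  by (intro ord_antisym) (auto simp: t_closed t_greatest)

end

section \<open>Transfer to other carrier types\<close>

text \<open>Validity is stated over one fixed carrier type, so a refutation found on another type
  has to be moved there. This is the copy along \<open>f\<close> of the subalgebra of
  \<open>L\<close> on \<open>S\<close>.\<close>

definition transport :: "('x, 'r) imp_order_scheme \<Rightarrow> 'x set \<Rightarrow> ('x \<Rightarrow> 'a) \<Rightarrow> 'a imp_order" where
  "transport L S f = \<lparr>carrier = f ` S, eq = (=),
     le = (\<lambda>x y. the_inv_into S f x \<sqsubseteq>\<^bsub>L\<^esub> the_inv_into S f y),
     imp = (\<lambda>x y. f (the_inv_into S f x \<leadsto>\<^bsub>L\<^esub> the_inv_into S f y))\<rparr>"

locale transported = fundamental_algebra L for L (structure) +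
  fixes S :: "'a set" and f :: "'a \<Rightarrow> 'c"
  assumes sub: "S \<subseteq> carrier L" and inj: "inj_on f S"
    and S_meet: "x \<in> S \<Longrightarrow> y \<in> S \<Longrightarrow> x \<sqinter> y \<in> S"
    and S_join: "x \<in> S \<Longrightarrow> y \<in> S \<Longrightarrow> x \<squnion> y \<in> S"
    and S_imp: "x \<in> S \<Longrightarrow> y \<in> S \<Longrightarrow> x \<leadsto> y \<in> S"
    and S_bot: "\<bottom> \<in> S" and S_top: "\<top> \<in> S"
begin

abbreviation "T \<equiv> transport L S f"

lemma S_carrier: "x \<in> S \<Longrightarrow> x \<in> carrier L"
  using sub by auto

lemma carrier_T: "carrier T = f ` S"
  by (simp add: transport_def)

lemma carrier_TE:
  assumes "a \<in> carrier T"
  obtains x where "x \<in> S" "a = f x"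
  using assms unfolding carrier_T by blast

lemma le_T: "x \<in> S \<Longrightarrow> y \<in> S \<Longrightarrow> f x \<sqsubseteq>\<^bsub>T\<^esub> f y \<longleftrightarrow> x \<sqsubseteq> y"
  by (simp add: transport_def the_inv_into_f_f[OF inj])

lemma imp_T: "x \<in> S \<Longrightarrow> y \<in> S \<Longrightarrow> f x \<leadsto>\<^bsub>T\<^esub> f y = f (x \<leadsto> y)"
  by (simp add: transport_def the_inv_into_f_f[OF inj])

sublocale T: presented_lattice T
  "\<lambda>x y. f (the_inv_into S f x \<sqinter> the_inv_into S f y)"
  "\<lambda>x y. f (the_inv_into S f x \<squnion> the_inv_into S f y)" "f \<bottom>" "f \<top>"
proof
  show "(.=\<^bsub>T\<^esub>) = (=)"
    by (simp add: transport_def)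
qed (auto simp: carrier_T le_T the_inv_into_f_f[OF inj] S_meet S_join S_bot S_top S_carrier
    meet_left meet_right join_left join_right meet_le join_le
    intro: le_trans[OF _ _ S_carrier S_carrier S_carrier] arg_cong[where f = f, OF le_antisym])

lemma meet_T: "x \<in> S \<Longrightarrow> y \<in> S \<Longrightarrow> f x \<sqinter>\<^bsub>T\<^esub> f y = f (x \<sqinter> y)"
  by (simp add: T.meet_eq carrier_T the_inv_into_f_f[OF inj])

lemma join_T: "x \<in> S \<Longrightarrow> y \<in> S \<Longrightarrow> f x \<squnion>\<^bsub>T\<^esub> f y = f (x \<squnion> y)"
  by (simp add: T.join_eq carrier_T the_inv_into_f_f[OF inj])

lemma S_neg: "x \<in> S \<Longrightarrow> \<sim>x \<in> S"
  by (simp add: neg_def S_imp S_bot)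

lemma neg_T: "x \<in> S \<Longrightarrow> \<sim>\<^bsub>T\<^esub> (f x) = f (\<sim>x)"
  by (simp add: neg_def T.bot_eq imp_T S_bot)

lemmas T_simps = carrier_T le_T imp_T meet_T join_T neg_T T.bot_eq T.top_eq'
  S_meet S_join S_imp S_neg S_bot S_top S_carrier

lemma fundamental_T: "fundamental_algebra T"
  by unfold_locales (auto simp: T_simps meet_neg le_neg_neg neg_antitone)

lemma orthomodular_T: "orthomodular_algebra T" if "orthomodular_algebra L"
proof -
  interpret O: orthomodular_algebra L by fact
  interpret FT: fundamental_algebra T by (rule fundamental_T)
  show ?thesis
  proof
    fix a b
    assume "a \<in> carrier T" "b \<in> carrier T"
    then obtain x y where "x \<in> S" "y \<in> S" "a = f x" "b = f y"
      by (auto simp: carrier_T)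
    then show "a \<sqinter>\<^bsub>T\<^esub> (a \<leadsto>\<^bsub>T\<^esub> b) \<sqsubseteq>\<^bsub>T\<^esub> b" "\<sim>\<^bsub>T\<^esub>(\<sim>\<^bsub>T\<^esub>a) = a"
      "a \<leadsto>\<^bsub>T\<^esub> b = \<sim>\<^bsub>T\<^esub>a \<squnion>\<^bsub>T\<^esub> (a \<sqinter>\<^bsub>T\<^esub> b)"
      by (simp_all only: T_simps O.modus_ponens) (simp_all only: T_simps O.neg_neg O.sasaki)
  qed
qed

lemma heyting_T: "heyting_algebra T" if "heyting_algebra L"
proof -
  interpret H: heyting_algebra L by fact
  interpret FT: fundamental_algebra T by (rule fundamental_T)
  show ?thesis
  proof
    fix a b c
    assume "a \<in> carrier T" "b \<in> carrier T" "c \<in> carrier T"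
    then obtain x y z where "x \<in> S" "y \<in> S" "z \<in> S" "a = f x" "b = f y" "c = f z"
      by (auto simp: carrier_T)
    then show "c \<sqinter>\<^bsub>T\<^esub> a \<sqsubseteq>\<^bsub>T\<^esub> b \<longleftrightarrow> c \<sqsubseteq>\<^bsub>T\<^esub> a \<leadsto>\<^bsub>T\<^esub> b"
      by (simp only: T_simps H.residuation)
  qed
qed

lemma iEx_T: "iEx_algebra T" if "iEx_algebra L"
proof -
  interpret I: iEx_algebra L by fact
  interpret FT: fundamental_algebra T by (rule fundamental_T)
  show ?thesis
  proof
    fix a b c d e g h
    assume car: "a \<in> carrier T" "b \<in> carrier T" "c \<in> carrier T" "d \<in> carrier T"
      "e \<in> carrier T" "g \<in> carrier T" "h \<in> carrier T"
    \<comment> \<open>The letter \<open>f\<close> is taken by the embedding, so the \<open>f\<close>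
      and \<open>g\<close> of iEx appear here as \<open>g\<close> and \<open>h\<close>.\<close>
    from car(1) obtain a' where a: "a' \<in> S" "a = f a'" by (rule carrier_TE)
    from car(2) obtain b' where b: "b' \<in> S" "b = f b'" by (rule carrier_TE)
    from car(3) obtain c' where c: "c' \<in> S" "c = f c'" by (rule carrier_TE)
    from car(4) obtain d' where d: "d' \<in> S" "d = f d'" by (rule carrier_TE)
    from car(5) obtain e' where e: "e' \<in> S" "e = f e'" by (rule carrier_TE)
    from car(6) obtain g' where g: "g' \<in> S" "g = f g'" by (rule carrier_TE)
    from car(7) obtain h' where h: "h' \<in> S" "h = f h'" by (rule carrier_TE)
    note S = a(1) b(1) c(1) d(1) e(1) g(1) h(1) and eqs = a(2) b(2) c(2) d(2) e(2) g(2) h(2)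
    show "((a \<sqinter>\<^bsub>T\<^esub> ((b \<sqinter>\<^bsub>T\<^esub> c) \<squnion>\<^bsub>T\<^esub> (b \<sqinter>\<^bsub>T\<^esub> d))) \<leadsto>\<^bsub>T\<^esub> h) \<sqinter>\<^bsub>T\<^esub> a
        \<sqinter>\<^bsub>T\<^esub> (c \<squnion>\<^bsub>T\<^esub> e) \<sqinter>\<^bsub>T\<^esub> \<sim>\<^bsub>T\<^esub>(\<sim>\<^bsub>T\<^esub>g)
      \<sqsubseteq>\<^bsub>T\<^esub> \<sim>\<^bsub>T\<^esub>(\<sim>\<^bsub>T\<^esub>(a \<sqinter>\<^bsub>T\<^esub> g)) \<sqinter>\<^bsub>T\<^esub> ((a \<sqinter>\<^bsub>T\<^esub> c) \<squnion>\<^bsub>T\<^esub> (a \<sqinter>\<^bsub>T\<^esub> e) \<squnion>\<^bsub>T\<^esub> g)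
        \<sqinter>\<^bsub>T\<^esub> ((b \<sqinter>\<^bsub>T\<^esub> (c \<squnion>\<^bsub>T\<^esub> d)) \<squnion>\<^bsub>T\<^esub> ((b \<sqinter>\<^bsub>T\<^esub> (c \<squnion>\<^bsub>T\<^esub> d)) \<leadsto>\<^bsub>T\<^esub> h))"
      unfolding eqs by (simp only: T_simps S) (intro I.iEx S_carrier S)
    show "\<sim>\<^bsub>T\<^esub>(a \<leadsto>\<^bsub>T\<^esub> b) = \<sim>\<^bsub>T\<^esub>(\<sim>\<^bsub>T\<^esub>a \<squnion>\<^bsub>T\<^esub> (a \<sqinter>\<^bsub>T\<^esub> b))"
      "a \<sqinter>\<^bsub>T\<^esub> (a \<leadsto>\<^bsub>T\<^esub> b) = a \<sqinter>\<^bsub>T\<^esub> b" "(a \<sqinter>\<^bsub>T\<^esub> b) \<leadsto>\<^bsub>T\<^esub> b = \<top>\<^bsub>T\<^esub>"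
      "a \<leadsto>\<^bsub>T\<^esub> (b \<sqinter>\<^bsub>T\<^esub> c) \<sqsubseteq>\<^bsub>T\<^esub> a \<leadsto>\<^bsub>T\<^esub> b"
      unfolding eqs using S
      by (simp_all only: T_simps I.neg_imp I.meet_imp I.imp_weaken I.imp_meet_le)
  qed
qed

lemma eval_in_S: "(\<And>p. v p \<in> S) \<Longrightarrow> eval L v \<chi> \<in> S"
  by (induction \<chi>) (auto simp: T_simps)

lemma eval_T: "(\<And>p. v p \<in> S) \<Longrightarrow> eval T (\<lambda>p. f (v p)) \<chi> = f (eval L v \<chi>)"
  by (induction \<chi>) (auto simp: T_simps eval_in_S)

end

section \<open>Countable subalgebras that carry a refutation\<close>

instance form :: (countable) countable
  by countable_datatype

lemma finite_set_form: "finite (set_form \<phi>)"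
  by (induction \<phi>) auto

lemma eval_cong_vars: "(\<And>p. p \<in> set_form \<chi> \<Longrightarrow> v p = w p) \<Longrightarrow> eval L v \<chi> = eval L w \<chi>"
  by (induction \<chi>) auto

lemma countable_into_infinite:
  assumes "countable S"
  obtains f :: "'x \<Rightarrow> 'a::infinite" where "inj_on f S"
proof -
  obtain g :: "nat \<Rightarrow> 'a" where "inj g"
    using infinite_UNIV infinite_countable_subset by blast
  then have "inj_on (g \<circ> to_nat_on S) S"
    using assms by (intro comp_inj_on inj_on_to_nat_on) (auto intro: inj_on_subset)
  then show thesis by (rule that)
qed

context fundamental_algebra
begin

lemma eval_closed: "(\<And>p. v p \<in> carrier L) \<Longrightarrow> eval L v \<chi> \<in> carrier L"
  by (induction \<chi>) (auto simp: imp_closed)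

text \<open>A refutation survives in a countable subalgebra, and a countable set embeds into every
  infinite type.\<close>

lemma refuting_transport:
  fixes \<phi> \<psi> :: "'v form"
  assumes "\<not> valid_in L \<phi> \<psi>"
  obtains S :: "'a set" and f :: "'a \<Rightarrow> 'c::infinite"
  where "transported L S f" "\<not> valid_in (transport L S f) \<phi> \<psi>"
proof -
  from assms obtain v where v: "v \<in> UNIV \<rightarrow> carrier L" "\<not> eval L v \<phi> \<sqsubseteq> eval L v \<psi>"
    by (auto simp: valid_in_def)
  \<comment> \<open>The values on the finitely many variables in use generate a countable subalgebra: it consists
    of the values of formulas over a countable set of variables.\<close>
  define X where "X = insert \<bottom> (v ` (set_form \<phi> \<union> set_form \<psi>))"
  have X: "countable X" "X \<noteq> {}" "X \<subseteq> carrier L"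
    using v(1) by (auto simp: X_def finite_set_form intro!: countable_finite)
  \<comment> \<open>The inserted \<open>\<bottom>\<close> keeps \<open>X\<close> nonempty even for
    formulas without variables, so \<open>from_nat_into\<close> enumerates exactly
    \<open>X\<close>.\<close>
  define w where "w = from_nat_into X"
  have rw: "range w = X"
    using X by (simp add: w_def range_from_nat_into)
  define S where "S = range (\<lambda>\<chi> :: nat form. eval L w \<chi>)"
  have wc: "w n \<in> carrier L" for n
    using rw X by auto
  have "countable S"
    by (simp add: S_def)
  then obtain f :: "'a \<Rightarrow> 'c" where f: "inj_on f S"
    by (rule countable_into_infinite)
  have XS: "X \<subseteq> S"
  proof -
    have "w n = eval L w (Var n)" for n by simp
    then show ?thesis using rw unfolding S_def by blast
  qed
  interpret transported L S f
  proof
    show "S \<subseteq> carrier L"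
      using wc by (auto simp: S_def eval_closed)
    show "inj_on f S" by fact
    have "\<bottom> = eval L w Zero" "\<top> = eval L w One"
      "eval L w \<alpha> \<sqinter> eval L w \<beta> = eval L w (And \<alpha> \<beta>)"
      "eval L w \<alpha> \<squnion> eval L w \<beta> = eval L w (Or \<alpha> \<beta>)"
      "eval L w \<alpha> \<leadsto> eval L w \<beta> = eval L w (Imp \<alpha> \<beta>)" for \<alpha> \<beta>
      by simp_all
    then show "\<bottom> \<in> S" "\<top> \<in> S" "\<And>x y. x \<in> S \<Longrightarrow> y \<in> S \<Longrightarrow> x \<sqinter> y \<in> S"
      "\<And>x y. x \<in> S \<Longrightarrow> y \<in> S \<Longrightarrow> x \<squnion> y \<in> S" "\<And>x y. x \<in> S \<Longrightarrow> y \<in> S \<Longrightarrow> x \<leadsto> y \<in> S"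
      unfolding S_def by (blast intro: range_eqI)+
  qed
  \<comment> \<open>On variables outside both formulas \<open>v\<close> may leave \<open>S\<close>;
    the default \<open>\<bottom>\<close> lies in \<open>S\<close> and does not affect the two
    values.\<close>
  define u where "u p = (if p \<in> set_form \<phi> \<union> set_form \<psi> then v p else \<bottom>)" for p
  have u: "u p \<in> S" for p
    using XS by (auto simp: u_def X_def)
  have "eval L u \<phi> = eval L v \<phi>" "eval L u \<psi> = eval L v \<psi>"
    by (auto intro!: eval_cong_vars simp: u_def)
  then have "\<not> eval T (\<lambda>p. f (u p)) \<phi> \<sqsubseteq>\<^bsub>T\<^esub> eval T (\<lambda>p. f (u p)) \<psi>"
    using v(2) u by (simp add: eval_T eval_in_S le_T flip: \<open>eval L u \<phi> = eval L v \<phi>\<close> \<open>eval L u \<psi> = eval L v \<psi>\<close>)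
  moreover have "(\<lambda>p. f (u p)) \<in> UNIV \<rightarrow> carrier T"
    using u by (auto simp: carrier_T)
  ultimately have "\<not> valid_in T \<phi> \<psi>"
    by (auto simp: valid_in_def)
  with transported_axioms show thesis by (rule that)
qed

end

text \<open>Validity over one infinite type reaches algebras over every type, since
  \<open>refuting_transport\<close> would bring a refutation back. The same argument serves the
  other two classes.\<close>

lemma orthomodular_valid_in:
  assumes "orthomodular_valid TYPE('c::infinite) \<phi> \<psi>" "orthomodular_algebra L"
  shows "valid_in L \<phi> \<psi>"
proof (rule ccontr)
  interpret orthomodular_algebra L by fact
  assume "\<not> valid_in L \<phi> \<psi>"
  then obtain S and f :: "_ \<Rightarrow> 'c" where "transported L S f" "\<not> valid_in (transport L S f) \<phi> \<psi>"
    by (rule refuting_transport)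
  with assms transported.orthomodular_T show False
    by (auto simp: orthomodular_valid_def)
qed

lemma heyting_valid_in:
  assumes "heyting_valid TYPE('c::infinite) \<phi> \<psi>" "heyting_algebra L"
  shows "valid_in L \<phi> \<psi>"
proof (rule ccontr)
  interpret heyting_algebra L by fact
  assume "\<not> valid_in L \<phi> \<psi>"
  then obtain S and f :: "_ \<Rightarrow> 'c" where "transported L S f" "\<not> valid_in (transport L S f) \<phi> \<psi>"
    by (rule refuting_transport)
  with assms transported.heyting_T show False
    by (auto simp: heyting_valid_def)
qed

lemma iEx_valid_in:
  assumes "iEx_valid TYPE('c::infinite) \<phi> \<psi>" "iEx_algebra L"
  shows "valid_in L \<phi> \<psi>"
proof (rule ccontr)
  interpret iEx_algebra L by fact
  assume "\<not> valid_in L \<phi> \<psi>"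
  then obtain S and f :: "_ \<Rightarrow> 'c" where "transported L S f" "\<not> valid_in (transport L S f) \<phi> \<psi>"
    by (rule refuting_transport)
  with assms transported.iEx_T show False
    by (auto simp: iEx_valid_def)
qed

section \<open>Heyting and orthomodular algebras satisfy the axioms\<close>

context fundamental_algebra
begin

declare imp_closed [simp]

lemma neg_closed [simp]: "a \<in> carrier L \<Longrightarrow> \<sim>a \<in> carrier L"
  by (simp add: neg_def)

lemma meet_le_left: "\<lbrakk>x \<sqsubseteq> z; x \<in> carrier L; y \<in> carrier L; z \<in> carrier L\<rbrakk> \<Longrightarrow> x \<sqinter> y \<sqsubseteq> z"
  by (rule le_trans[OF meet_left]) auto

lemma meet_le_right: "\<lbrakk>y \<sqsubseteq> z; x \<in> carrier L; y \<in> carrier L; z \<in> carrier L\<rbrakk> \<Longrightarrow> x \<sqinter> y \<sqsubseteq> z"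
  by (rule le_trans[OF meet_right]) auto

lemma le_join_left: "\<lbrakk>z \<sqsubseteq> x; x \<in> carrier L; y \<in> carrier L; z \<in> carrier L\<rbrakk> \<Longrightarrow> z \<sqsubseteq> x \<squnion> y"
  by (rule le_trans[OF _ join_left]) auto

lemma le_join_right: "\<lbrakk>z \<sqsubseteq> y; x \<in> carrier L; y \<in> carrier L; z \<in> carrier L\<rbrakk> \<Longrightarrow> z \<sqsubseteq> x \<squnion> y"
  by (rule le_trans[OF _ join_right]) auto

lemma le_bot_eq: "\<lbrakk>x \<sqsubseteq> \<bottom>; x \<in> carrier L\<rbrakk> \<Longrightarrow> x = \<bottom>"
  by (rule le_antisym) auto

lemma top_le_eq: "\<lbrakk>\<top> \<sqsubseteq> x; x \<in> carrier L\<rbrakk> \<Longrightarrow> x = \<top>"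
  by (rule le_antisym) auto

lemma neg_neg_neg: "a \<in> carrier L \<Longrightarrow> \<sim>\<sim>\<sim>a = \<sim>a"
  by (intro le_antisym neg_antitone le_neg_neg) auto

text \<open>The law \<open>a \<sqinter> \<sim>a = \<bottom>\<close> at \<open>\<top>\<close> gives
  \<open>\<sim>\<top> = \<bottom>\<close>; then
  \<open>\<top> \<sqsubseteq> \<sim>\<sim>\<top>\<close> makes \<open>\<sim>\<bottom>\<close> the
  top.\<close>

lemma neg_bot: "\<sim>\<bottom> = \<top>"
proof -
  have "\<sim>\<top> \<sqsubseteq> \<bottom>"
    using meet_neg[of \<top>] meet_le[of "\<sim>\<top>" \<top> "\<sim>\<top>"] by simp
  then have "\<sim>\<top> = \<bottom>"
    by (simp add: le_bot_eq)
  then show ?thesis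
    using le_neg_neg[of \<top>] by (simp add: top_le_eq)
qed

lemma neg_top: "\<sim>\<top> = \<bottom>"
  using meet_neg[of \<top>] meet_le[of "\<sim>\<top>" \<top> "\<sim>\<top>"] by (simp add: le_bot_eq)

lemma meet3_le:
  assumes "x \<in> carrier L" "y \<in> carrier L" "z \<in> carrier L"
  shows "x \<sqinter> y \<sqinter> z \<sqsubseteq> x" "x \<sqinter> y \<sqinter> z \<sqsubseteq> y" "x \<sqinter> y \<sqinter> z \<sqsubseteq> z"
  using assms by (simp_all add: meet_right meet_le_left[OF meet_left] meet_le_left[OF meet_right])

lemma meet4_le:
  assumes "w \<in> carrier L" "x \<in> carrier L" "y \<in> carrier L" "z \<in> carrier L"
  shows "w \<sqinter> x \<sqinter> y \<sqinter> z \<sqsubseteq> w" "w \<sqinter> x \<sqinter> y \<sqinter> z \<sqsubseteq> x" "w \<sqinter> x \<sqinter> y \<sqinter> z \<sqsubseteq> y"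
    "w \<sqinter> x \<sqinter> y \<sqinter> z \<sqsubseteq> z"
  using assms by (simp_all add: meet_right meet_le_left meet3_le)

end

section \<open>The axioms in Heyting algebras\<close>

context heyting_algebra
begin

lemma modus_ponens_le: "\<lbrakk>a \<in> carrier L; b \<in> carrier L\<rbrakk> \<Longrightarrow> (a \<leadsto> b) \<sqinter> a \<sqsubseteq> b"
  by (simp add: residuation)

lemma le_neg_iff: "\<lbrakk>a \<in> carrier L; c \<in> carrier L\<rbrakk> \<Longrightarrow> c \<sqsubseteq> \<sim>a \<longleftrightarrow> c \<sqinter> a \<sqsubseteq> \<bottom>"
  by (simp add: neg_def residuation)

text \<open>Meeting with \<open>a\<close> is left adjoint to implication from \<open>a\<close>,
  hence preserves joins.\<close>

lemma distrib_le:
  assumes [simp]: "a \<in> carrier L" "b \<in> carrier L" "c \<in> carrier L"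
  shows "a \<sqinter> (b \<squnion> c) \<sqsubseteq> (a \<sqinter> b) \<squnion> (a \<sqinter> c)"
proof -
  have "b \<sqsubseteq> a \<leadsto> (a \<sqinter> b) \<squnion> (a \<sqinter> c)" "c \<sqsubseteq> a \<leadsto> (a \<sqinter> b) \<squnion> (a \<sqinter> c)"
    by (simp_all add: meet_comm join_left join_right flip: residuation)
  then have "b \<squnion> c \<sqsubseteq> a \<leadsto> (a \<sqinter> b) \<squnion> (a \<sqinter> c)"
    by (simp add: join_le)
  then show ?thesis
    by (simp add: meet_comm flip: residuation)
qed

text \<open>By currying, \<open>\<sim>(a \<sqinter> f)\<close> and \<open>a\<close> together entail
  \<open>\<sim>f\<close>, which contradicts \<open>\<sim>\<sim>f\<close>.\<close>

lemma meet_neg_neg_le: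
  assumes [simp]: "a \<in> carrier L" "f \<in> carrier L"
  shows "a \<sqinter> \<sim>\<sim>f \<sqsubseteq> \<sim>\<sim>(a \<sqinter> f)"
proof -
  let ?n = "\<sim>(a \<sqinter> f)"
  have "?n \<sqinter> a \<sqinter> f \<sqsubseteq> ?n \<sqinter> (a \<sqinter> f)"
    by (intro meet_le) (simp_all add: meet3_le)
  also have "\<dots> \<sqsubseteq> \<bottom>"
    by (simp flip: le_neg_iff)
  finally have n: "?n \<sqinter> a \<sqsubseteq> \<sim>f"
    by (simp add: le_neg_iff)
  have "a \<sqinter> \<sim>\<sim>f \<sqinter> ?n \<sqsubseteq> \<sim>\<sim>f \<sqinter> (?n \<sqinter> a)"
    by (intro meet_le) (simp_all add: meet3_le)
  also have "\<dots> \<sqsubseteq> \<sim>\<sim>f \<sqinter> \<sim>f"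
    using n by (intro meet_le) (auto intro: meet_le_right meet_left)
  also have "\<dots> \<sqsubseteq> \<bottom>"
    by (simp flip: le_neg_iff)
  finally show ?thesis
    by (simp add: le_neg_iff)
qed

text \<open>The conjuncts of iEx come from \<open>meet_neg_neg_le\<close>, from distributivity, and
  from distributivity followed by modus ponens. In the last one the antecedent already lies below
  the disjunct that is an implication.\<close>

lemma iEx_algebra: "iEx_algebra L"
proof
  fix a b c d e f g
  assume [simp]: "a \<in> carrier L" "b \<in> carrier L" "c \<in> carrier L" "d \<in> carrier L"
    "e \<in> carrier L" "f \<in> carrier L" "g \<in> carrier L"
  let ?R = "(b \<sqinter> c) \<squnion> (b \<sqinter> d)" and ?Q = "b \<sqinter> (c \<squnion> d)"
  let ?X = "((a \<sqinter> ?R) \<leadsto> g) \<sqinter> a \<sqinter> (c \<squnion> e) \<sqinter> \<sim>\<sim>f"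
  have X: "?X \<sqsubseteq> (a \<sqinter> ?R) \<leadsto> g" "?X \<sqsubseteq> a" "?X \<sqsubseteq> c \<squnion> e" "?X \<sqsubseteq> \<sim>\<sim>f"
    by (simp_all add: meet4_le)
  have "?X \<sqsubseteq> \<sim>\<sim>(a \<sqinter> f)"
    by (rule le_trans[OF meet_le meet_neg_neg_le]) (simp_all add: X)
  moreover have "?X \<sqsubseteq> (a \<sqinter> c) \<squnion> (a \<sqinter> e) \<squnion> f"
    by (rule le_join_left, rule le_trans[OF meet_le distrib_le]) (simp_all add: X)
  moreover have "?X \<sqsubseteq> ?Q \<squnion> (?Q \<leadsto> g)"
  proof -
    have "?X \<sqinter> ?Q \<sqsubseteq> ((a \<sqinter> ?R) \<leadsto> g) \<sqinter> (a \<sqinter> ?R)"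
      by (intro meet_le) (simp_all add: X meet_le_left meet_le_right[OF distrib_le])
    also have "\<dots> \<sqsubseteq> g"
      by (simp add: modus_ponens_le)
    finally show ?thesis
      by (intro le_join_right) (simp_all add: residuation)
  qed
  ultimately show "?X \<sqsubseteq> \<sim>\<sim>(a \<sqinter> f) \<sqinter> ((a \<sqinter> c) \<squnion> (a \<sqinter> e) \<squnion> f) \<sqinter> (?Q \<squnion> (?Q \<leadsto> g))"
    by (intro meet_le) auto
next
  fix a b
  assume [simp]: "a \<in> carrier L" "b \<in> carrier L"
  let ?s = "\<sim>a \<squnion> (a \<sqinter> b)"
  have "\<sim>a \<sqinter> a \<sqsubseteq> b"
    by (rule le_trans[of _ \<bottom>]) (simp_all flip: le_neg_iff)
  then have "?s \<sqsubseteq> a \<leadsto> b"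
    by (intro join_le) (simp_all add: meet3_le flip: residuation)
  moreover have "\<sim>?s \<sqsubseteq> \<sim>(a \<leadsto> b)"
  proof -
    \<comment> \<open>Two rounds refute \<open>?t\<close>: together with \<open>a\<close> it entails
      \<open>a \<sqinter> b\<close>, one part of \<open>?s\<close>, so it lies below
      \<open>\<sim>a\<close>; but that is the other part of \<open>?s\<close>.\<close>
    let ?t = "\<sim>?s \<sqinter> (a \<leadsto> b)"
    have "?t \<sqinter> a \<sqsubseteq> a" "?t \<sqinter> a \<sqsubseteq> \<sim>?s" "?t \<sqinter> a \<sqsubseteq> (a \<leadsto> b) \<sqinter> a"
      by (simp_all add: meet_le meet3_le)
    moreover from this(3) have "?t \<sqinter> a \<sqsubseteq> b"
      by (rule le_trans) (simp_all add: modus_ponens_le)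
    ultimately have "?t \<sqinter> a \<sqsubseteq> \<sim>?s \<sqinter> ?s"
      by (intro meet_le le_join_right) auto
    also have "\<dots> \<sqsubseteq> \<bottom>"
      by (simp flip: le_neg_iff)
    finally have "?t \<sqsubseteq> \<sim>a"
      by (simp add: le_neg_iff)
    then have "?t \<sqsubseteq> \<sim>?s \<sqinter> ?s"
      by (intro meet_le le_join_left) (auto intro: meet_left)
    also have "\<dots> \<sqsubseteq> \<bottom>"
      by (simp flip: le_neg_iff)
    finally show ?thesis
      by (simp add: le_neg_iff)
  qed
  ultimately show "\<sim>(a \<leadsto> b) = \<sim>?s"
    by (simp add: le_antisym neg_antitone)
  have "a \<sqinter> (a \<leadsto> b) \<sqsubseteq> b"
    using modus_ponens_le[of a b] by (simp add: meet_comm)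
  moreover have "b \<sqsubseteq> a \<leadsto> b"
    by (simp add: meet_left flip: residuation)
  ultimately show "a \<sqinter> (a \<leadsto> b) = a \<sqinter> b"
    by (intro le_antisym meet_le) (auto intro: meet_left meet_le_right)
  show "(a \<sqinter> b) \<leadsto> b = \<top>"
    by (intro top_le_eq) (simp_all add: meet_le_right[OF meet_right] flip: residuation)
next
  fix a b c
  assume [simp]: "a \<in> carrier L" "b \<in> carrier L" "c \<in> carrier L"
  have "(a \<leadsto> (b \<sqinter> c)) \<sqinter> a \<sqsubseteq> b"
    by (rule le_trans[OF modus_ponens_le meet_left]) auto
  then show "a \<leadsto> (b \<sqinter> c) \<sqsubseteq> a \<leadsto> b"
    by (simp add: residuation)
qed

end

section \<open>The axioms in orthomodular algebras\<close>

context orthomodular_algebra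
begin

text \<open>The negation of the join lies below both \<open>\<sim>a\<close> and
  \<open>\<sim>\<sim>a\<close>, so it is \<open>\<bottom>\<close>; involution turns this into the
  claim.\<close>

lemma excluded_middle:
  assumes [simp]: "a \<in> carrier L"
  shows "\<sim>a \<squnion> a = \<top>"
proof -
  let ?n = "\<sim>(\<sim>a \<squnion> a)"
  have "?n \<sqsubseteq> \<sim>\<sim>a" "?n \<sqsubseteq> \<sim>a"
    by (auto intro!: neg_antitone join_left join_right)
  then have "?n \<sqsubseteq> \<sim>a \<sqinter> \<sim>\<sim>a"
    by (intro meet_le) auto
  then have "?n = \<bottom>"
    by (simp add: meet_neg le_bot_eq del: neg_neg)
  then show ?thesis
    using neg_neg[of "\<sim>a \<squnion> a"] by (simp add: neg_bot)
qed

text \<open>Since \<open>\<sim>\<sim>f = f\<close>, the antecedent of iEx is below \<open>a\<close>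
  and \<open>f\<close>, which gives the first two conjuncts. The third is \<open>\<top>\<close>,
  because a Sasaki implication lies above the negation of its antecedent.\<close>

lemma iEx_algebra: "iEx_algebra L"
proof
  fix a b c d e f g
  assume [simp]: "a \<in> carrier L" "b \<in> carrier L" "c \<in> carrier L" "d \<in> carrier L"
    "e \<in> carrier L" "f \<in> carrier L" "g \<in> carrier L"
  let ?R = "(b \<sqinter> c) \<squnion> (b \<sqinter> d)" and ?Q = "b \<sqinter> (c \<squnion> d)"
  let ?X = "((a \<sqinter> ?R) \<leadsto> g) \<sqinter> a \<sqinter> (c \<squnion> e) \<sqinter> \<sim>\<sim>f"
  have X: "?X \<sqsubseteq> a" "?X \<sqsubseteq> f"
    using meet4_le[of "(a \<sqinter> ?R) \<leadsto> g" a "c \<squnion> e" "\<sim>\<sim>f"] by (simp_all add: neg_neg)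
  have "\<sim>?Q \<squnion> ?Q \<sqsubseteq> ?Q \<squnion> (?Q \<leadsto> g)"
    by (intro join_le) (simp_all add: sasaki join_left le_join_right[OF join_left])
  then have "?Q \<squnion> (?Q \<leadsto> g) = \<top>"
    by (simp add: excluded_middle top_le_eq)
  moreover have "?X \<sqsubseteq> \<sim>\<sim>(a \<sqinter> f)"
    using X by (simp add: neg_neg[of "a \<sqinter> f"] meet_le)
  moreover have "?X \<sqsubseteq> (a \<sqinter> c) \<squnion> (a \<sqinter> e) \<squnion> f"
    using X by (intro le_join_right) auto
  ultimately show "?X \<sqsubseteq> \<sim>\<sim>(a \<sqinter> f) \<sqinter> ((a \<sqinter> c) \<squnion> (a \<sqinter> e) \<squnion> f) \<sqinter> (?Q \<squnion> (?Q \<leadsto> g))"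
    by (intro meet_le) auto
next
  fix a b
  assume [simp]: "a \<in> carrier L" "b \<in> carrier L"
  show "\<sim>(a \<leadsto> b) = \<sim>(\<sim>a \<squnion> (a \<sqinter> b))"
    by (simp add: sasaki)
  show "a \<sqinter> (a \<leadsto> b) = a \<sqinter> b"
    using modus_ponens[of a b]
    by (intro le_antisym meet_le) (auto intro: meet_left meet_right join_right simp: sasaki)
  have "(a \<sqinter> b) \<sqinter> b = a \<sqinter> b"
    by (intro le_antisym meet_le) (simp_all add: meet_left meet_right meet3_le)
  then show "(a \<sqinter> b) \<leadsto> b = \<top>"
    by (simp add: sasaki excluded_middle)
next
  fix a b c
  assume [simp]: "a \<in> carrier L" "b \<in> carrier L" "c \<in> carrier L"
  have "a \<sqinter> (b \<sqinter> c) \<sqsubseteq> a \<sqinter> b"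
    by (intro meet_le) (simp_all add: meet_left meet_le_right[OF meet_left])
  then show "a \<leadsto> (b \<sqinter> c) \<sqsubseteq> a \<leadsto> b"
    by (auto simp: sasaki intro!: join_le intro: join_left le_join_right)
qed

end

section \<open>The orthomodular algebra of regular elements\<close>

context iEx_algebra
begin

lemma le_imp_top:
  assumes [simp]: "x \<in> carrier L" "y \<in> carrier L" and "x \<sqsubseteq> y"
  shows "x \<leadsto> y = \<top>"
proof -
  have "x \<sqinter> y = x"
    using assms by (intro le_antisym meet_le) (auto intro: meet_left)
  then show ?thesis
    using imp_weaken[of x y] by simp
qed

text \<open>A form of iEx made for instantiation: suitable parameters turn some of the four bounds
  on \<open>z\<close> into trivial ones, and each conjunct can be used alone.\<close>

lemma iEx_parts:
  assumes [simp]: "a \<in> carrier L" "b \<in> carrier L" "c \<in> carrier L" "d \<in> carrier L"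
      "e \<in> carrier L" "f \<in> carrier L" "g \<in> carrier L" "z \<in> carrier L"
    and z: "z \<sqsubseteq> (a \<sqinter> ((b \<sqinter> c) \<squnion> (b \<sqinter> d))) \<leadsto> g" "z \<sqsubseteq> a" "z \<sqsubseteq> c \<squnion> e" "z \<sqsubseteq> \<sim>\<sim>f"
  shows "z \<sqsubseteq> \<sim>\<sim>(a \<sqinter> f)" "z \<sqsubseteq> (a \<sqinter> c) \<squnion> (a \<sqinter> e) \<squnion> f"
    "z \<sqsubseteq> (b \<sqinter> (c \<squnion> d)) \<squnion> ((b \<sqinter> (c \<squnion> d)) \<leadsto> g)"
proof -
  have "z \<sqsubseteq> ((a \<sqinter> ((b \<sqinter> c) \<squnion> (b \<sqinter> d))) \<leadsto> g) \<sqinter> a \<sqinter> (c \<squnion> e) \<sqinter> \<sim>\<sim>f"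
    using z by (intro meet_le) auto
  also note iEx[of a b c d e f g]
  finally have z: "z \<sqsubseteq> \<sim>\<sim>(a \<sqinter> f) \<sqinter> ((a \<sqinter> c) \<squnion> (a \<sqinter> e) \<squnion> f)
      \<sqinter> ((b \<sqinter> (c \<squnion> d)) \<squnion> ((b \<sqinter> (c \<squnion> d)) \<leadsto> g))"
    by simp
  show "z \<sqsubseteq> \<sim>\<sim>(a \<sqinter> f)" "z \<sqsubseteq> (a \<sqinter> c) \<squnion> (a \<sqinter> e) \<squnion> f"
    "z \<sqsubseteq> (b \<sqinter> (c \<squnion> d)) \<squnion> ((b \<sqinter> (c \<squnion> d)) \<leadsto> g)"
    by (rule le_trans[OF z]; simp add: meet3_le)+
qed

text \<open>With \<open>\<top>\<close> for \<open>g\<close> the implication in iEx is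
  \<open>\<top>\<close>, and with \<open>\<top>\<close> for \<open>c\<close> and \<open>e\<close> so
  is their join. Only the bounds \<open>a\<close> and \<open>\<sim>\<sim>f\<close> remain.\<close>

lemma meet_neg_neg_le:
  assumes [simp]: "a \<in> carrier L" "f \<in> carrier L"
  shows "a \<sqinter> \<sim>\<sim>f \<sqsubseteq> \<sim>\<sim>(a \<sqinter> f)"
  by (rule iEx_parts(1)[of _ \<top> \<top> \<top> \<top> _ \<top>])
    (auto simp: le_imp_top intro: le_join_left meet_left meet_right)

text \<open>Here \<open>g\<close> is \<open>\<top>\<close>. Below \<open>\<sim>\<sim>f\<close> the
  lattice is thus distributive up to joining with \<open>f\<close>.\<close>

lemma distrib_below_neg_neg:
  assumes [simp]: "a \<in> carrier L" "c \<in> carrier L" "e \<in> carrier L" "f \<in> carrier L"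
  shows "a \<sqinter> (c \<squnion> e) \<sqinter> \<sim>\<sim>f \<sqsubseteq> (a \<sqinter> c) \<squnion> (a \<sqinter> e) \<squnion> f"
  by (rule iEx_parts(2)[of _ \<top> _ \<top> _ _ \<top>])
    (simp_all add: le_imp_top meet3_le le_join_left)

text \<open>Putting \<open>\<top>\<close> for \<open>e\<close> and \<open>f\<close> makes the last
  two bounds of iEx trivial and isolates its third conjunct.\<close>

lemma imp_disj:
  assumes [simp]: "a \<in> carrier L" "b \<in> carrier L" "c \<in> carrier L" "d \<in> carrier L" "g \<in> carrier L"
  shows "((a \<sqinter> ((b \<sqinter> c) \<squnion> (b \<sqinter> d))) \<leadsto> g) \<sqinter> a
    \<sqsubseteq> (b \<sqinter> (c \<squnion> d)) \<squnion> ((b \<sqinter> (c \<squnion> d)) \<leadsto> g)"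
  using le_neg_neg[of \<top>]
  by (intro iEx_parts(3)[of a _ _ _ \<top> \<top>])
    (auto simp: neg_top neg_bot intro: le_join_right meet_left meet_right)

lemma neg_neg_mono: "\<lbrakk>x \<sqsubseteq> y; x \<in> carrier L; y \<in> carrier L\<rbrakk> \<Longrightarrow> \<sim>\<sim>x \<sqsubseteq> \<sim>\<sim>y"
  by (auto intro!: neg_antitone)

text \<open>For the nontrivial direction \<open>meet_neg_neg_le\<close> pulls the double negation
  out of one argument at a time, and four negations collapse to two.\<close>

lemma neg_neg_meet:
  assumes [simp]: "x \<in> carrier L" "y \<in> carrier L"
  shows "\<sim>\<sim>(x \<sqinter> y) = \<sim>\<sim>x \<sqinter> \<sim>\<sim>y"
proof (rule le_antisym)
  show "\<sim>\<sim>(x \<sqinter> y) \<sqsubseteq> \<sim>\<sim>x \<sqinter> \<sim>\<sim>y"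
    by (intro meet_le neg_neg_mono) (auto intro: meet_left meet_right)
  have "\<sim>\<sim>x \<sqinter> \<sim>\<sim>y \<sqsubseteq> \<sim>\<sim>(\<sim>\<sim>x \<sqinter> y)"
    by (rule meet_neg_neg_le) auto
  also have "\<dots> \<sqsubseteq> \<sim>\<sim>(\<sim>\<sim>(x \<sqinter> y))"
    using meet_neg_neg_le[of y x] by (intro neg_neg_mono) (simp_all add: meet_comm)
  finally show "\<sim>\<sim>x \<sqinter> \<sim>\<sim>y \<sqsubseteq> \<sim>\<sim>(x \<sqinter> y)"
    by (simp add: neg_neg_neg)
qed auto

text \<open>The element \<open>x \<squnion> \<sim>\<sim>y\<close> lies between
  \<open>x \<squnion> y\<close> and \<open>\<sim>\<sim>(x \<squnion> y)\<close>, and these two have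
  the same negation.\<close>

lemma neg_join_neg_neg:
  assumes [simp]: "x \<in> carrier L" "y \<in> carrier L"
  shows "\<sim>(x \<squnion> \<sim>\<sim>y) = \<sim>(x \<squnion> y)"
proof (rule le_antisym)
  show "\<sim>(x \<squnion> \<sim>\<sim>y) \<sqsubseteq> \<sim>(x \<squnion> y)"
    by (intro neg_antitone join_le) (simp_all add: join_left le_join_right[OF le_neg_neg])
  have "x \<squnion> \<sim>\<sim>y \<sqsubseteq> \<sim>\<sim>(x \<squnion> y)"
    by (intro join_le neg_neg_mono le_trans[OF join_left le_neg_neg]) (auto intro: join_right)
  then have "\<sim>\<sim>\<sim>(x \<squnion> y) \<sqsubseteq> \<sim>(x \<squnion> \<sim>\<sim>y)"
    by (intro neg_antitone) auto
  then show "\<sim>(x \<squnion> y) \<sqsubseteq> \<sim>(x \<squnion> \<sim>\<sim>y)"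
    by (simp add: neg_neg_neg)
qed auto

text \<open>Under a negation \<open>neg_imp\<close> replaces the implication by the Sasaki term,
  where double negations are already under control.\<close>

lemma neg_imp_neg_neg:
  assumes [simp]: "x \<in> carrier L" "y \<in> carrier L"
  shows "\<sim>(\<sim>\<sim>x \<leadsto> \<sim>\<sim>y) = \<sim>(x \<leadsto> y)"
  using neg_join_neg_neg[of "\<sim>x" "x \<sqinter> y"]
  by (simp add: neg_imp neg_neg_neg neg_neg_meet)

text \<open>The double negation in \<open>imp\<close> keeps the result among the regular elements.
  The join, determined by the order, is the double negation of the join in \<open>L\<close>.\<close>

definition regular_algebra :: "'a imp_order" where
  "regular_algebra = \<lparr>carrier = {a \<in> carrier L. \<sim>\<sim>a = a}, eq = (=), le = (\<sqsubseteq>),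
     imp = (\<lambda>a b. \<sim>\<sim>(a \<leadsto> b))\<rparr>"

abbreviation "R \<equiv> regular_algebra"

lemma R_sel:
  "x \<in> carrier R \<longleftrightarrow> x \<in> carrier L \<and> \<sim>\<sim>x = x"
  "x \<sqsubseteq>\<^bsub>R\<^esub> y \<longleftrightarrow> x \<sqsubseteq> y" "x \<leadsto>\<^bsub>R\<^esub> y = \<sim>\<sim>(x \<leadsto> y)"
  by (auto simp: regular_algebra_def)

lemma neg_neg_least: "\<lbrakk>x \<sqsubseteq> z; \<sim>\<sim>z = z; x \<in> carrier L; z \<in> carrier L\<rbrakk> \<Longrightarrow> \<sim>\<sim>x \<sqsubseteq> z"
  using neg_neg_mono[of x z] by simp

sublocale R: presented_lattice R "(\<sqinter>)" "\<lambda>x y. \<sim>\<sim>(x \<squnion> y)" \<bottom> \<top>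
proof
  show "(.=\<^bsub>R\<^esub>) = (=)"
    by (simp add: regular_algebra_def)
qed (auto simp: R_sel neg_top neg_bot neg_neg_meet neg_neg_neg meet_left meet_right
    intro: le_trans meet_le neg_neg_least join_le le_trans[OF join_left le_neg_neg]
      le_trans[OF join_right le_neg_neg])

lemma R_simps:
  "\<lbrakk>x \<in> carrier R; y \<in> carrier R\<rbrakk> \<Longrightarrow> x \<sqinter>\<^bsub>R\<^esub> y = x \<sqinter> y"
  "\<lbrakk>x \<in> carrier R; y \<in> carrier R\<rbrakk> \<Longrightarrow> x \<squnion>\<^bsub>R\<^esub> y = \<sim>\<sim>(x \<squnion> y)"
  "\<bottom>\<^bsub>R\<^esub> = \<bottom>" "\<top>\<^bsub>R\<^esub> = \<top>"
  by (simp_all add: R.meet_eq R.join_eq R.bot_eq R.top_eq')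

lemma neg_R: "x \<in> carrier L \<Longrightarrow> \<sim>\<^bsub>R\<^esub>x = \<sim>x"
  by (simp add: neg_def[of R] R_simps R_sel neg_neg_neg flip: neg_def)

text \<open>Involution holds by choice of the carrier. Modus ponens follows from
  \<open>meet_imp\<close> because double negation preserves meets, and the Sasaki equation is
  \<open>neg_imp\<close> negated once more.\<close>

lemma regular_orthomodular: "orthomodular_algebra R"
proof -
  have mp: "a \<sqinter> \<sim>\<sim>(a \<leadsto> b) \<sqsubseteq> b"
    if [simp]: "a \<in> carrier L" "b \<in> carrier L" "\<sim>\<sim>a = a" "\<sim>\<sim>b = b" for a b
  proof -
    have "a \<sqinter> \<sim>\<sim>(a \<leadsto> b) = \<sim>\<sim>(a \<sqinter> (a \<leadsto> b))"
      by (simp add: neg_neg_meet)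
    also have "\<dots> = a \<sqinter> b"
      by (simp add: meet_imp neg_neg_meet)
    finally show ?thesis
      by (simp add: meet_right)
  qed
  show ?thesis
  proof
    fix a b
    assume "a \<in> carrier R" "b \<in> carrier R"
    then have [simp]: "a \<in> carrier L" "b \<in> carrier L" "\<sim>\<sim>a = a" "\<sim>\<sim>b = b"
      by (simp_all add: R_sel)
    have cl: "\<sim>a \<in> carrier R" "\<sim>\<sim>(a \<leadsto> b) \<in> carrier R" "a \<in> carrier R" "b \<in> carrier R"
        "a \<sqinter> b \<in> carrier R"
      by (simp_all add: R_sel neg_neg_neg neg_neg_meet)
    show "a \<leadsto>\<^bsub>R\<^esub> b \<in> carrier R"
      using cl by (simp add: R_sel)
    show "\<sim>\<^bsub>R\<^esub>b \<sqsubseteq>\<^bsub>R\<^esub> \<sim>\<^bsub>R\<^esub>a" if "a \<sqsubseteq>\<^bsub>R\<^esub> b"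
      using that by (simp add: R_sel neg_R neg_antitone)
    show "a \<sqinter>\<^bsub>R\<^esub> (a \<leadsto>\<^bsub>R\<^esub> b) \<sqsubseteq>\<^bsub>R\<^esub> b"
      using cl by (simp only: R_simps R_sel(2,3)) (simp add: mp)
    show "a \<leadsto>\<^bsub>R\<^esub> b = \<sim>\<^bsub>R\<^esub>a \<squnion>\<^bsub>R\<^esub> (a \<sqinter>\<^bsub>R\<^esub> b)"
      using cl by (simp add: R_simps neg_R R_sel(3) neg_imp)
  qed (auto simp: R_sel R_simps neg_R meet_neg neg_neg_neg)
qed

text \<open>Double negation is a homomorphism onto the regular elements; the cases are the
  commutation laws for meet, join and implication above.\<close>

lemma eval_regular:
  "(\<And>p. v p \<in> carrier L) \<Longrightarrow> eval R (\<lambda>p. \<sim>\<sim>v p) \<chi> = \<sim>\<sim>eval L v \<chi>"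
proof (induction \<chi>)
  case (Or \<alpha> \<beta>)
  then have [simp]: "eval L v \<alpha> \<in> carrier L" "eval L v \<beta> \<in> carrier L"
    by (simp_all add: eval_closed)
  have "\<sim>(\<sim>\<sim>eval L v \<alpha> \<squnion> \<sim>\<sim>eval L v \<beta>) = \<sim>(eval L v \<alpha> \<squnion> eval L v \<beta>)"
    using neg_join_neg_neg[of "eval L v \<beta>" "eval L v \<alpha>"]
    by (simp add: neg_join_neg_neg join_comm)
  then show ?case
    using Or by (simp add: R_simps R_sel neg_neg_neg)
qed (auto simp: eval_closed R_simps R_sel neg_neg_neg neg_neg_meet neg_imp_neg_neg neg_top neg_bot)

end

section \<open>Heyting algebras of upsets\<close>

text \<open>The algebra of propositions of the Kripke frame \<open>W\<close>, with the forcing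
  clause for implication. For a set of filters the frame order is inclusion.\<close>

definition upset_algebra :: "'w::order set \<Rightarrow> 'w set imp_order" where
  "upset_algebra W = \<lparr>carrier = {U. U \<subseteq> W \<and> (\<forall>F\<in>U. \<forall>G\<in>W. F \<le> G \<longrightarrow> G \<in> U)},
     eq = (=), le = (\<subseteq>), imp = (\<lambda>U V. {F\<in>W. \<forall>G\<in>W. F \<le> G \<and> G \<in> U \<longrightarrow> G \<in> V})\<rparr>"

lemma upset_algebra_sel:
  "U \<in> carrier (upset_algebra W) \<longleftrightarrow> U \<subseteq> W \<and> (\<forall>F\<in>U. \<forall>G\<in>W. F \<le> G \<longrightarrow> G \<in> U)"
  "U \<sqsubseteq>\<^bsub>upset_algebra W\<^esub> V \<longleftrightarrow> U \<subseteq> V"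
  "U \<leadsto>\<^bsub>upset_algebra W\<^esub> V = {F\<in>W. \<forall>G\<in>W. F \<le> G \<and> G \<in> U \<longrightarrow> G \<in> V}"
  by (simp_all add: upset_algebra_def)

interpretation upset_algebra: presented_lattice "upset_algebra W" "(\<inter>)" "(\<union>)" "{}" W
  for W :: "'w::order set"
proof
  show "(.=\<^bsub>upset_algebra W\<^esub>) = (=)"
    by (simp add: upset_algebra_def)
qed (auto simp: upset_algebra_sel)

lemma heyting_upset_algebra: "heyting_algebra (upset_algebra W)" for W :: "'w::order set"
proof -
  let ?H = "upset_algebra W"
  have imp_cl: "U \<leadsto>\<^bsub>?H\<^esub> V \<in> carrier ?H" for U V
    by (auto simp: upset_algebra_sel intro: order.trans)
  have neg: "\<sim>\<^bsub>?H\<^esub>U = {F\<in>W. \<forall>G\<in>W. F \<le> G \<longrightarrow> G \<notin> U}" for U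
    by (auto simp: neg_def upset_algebra_sel upset_algebra.bot_eq)
  have neg_cl: "\<sim>\<^bsub>?H\<^esub>U \<in> carrier ?H" for U
    by (auto simp: neg_def imp_cl)
  show ?thesis
  proof
    fix A B C
    assume car: "A \<in> carrier ?H" "B \<in> carrier ?H" "C \<in> carrier ?H"
    show "A \<leadsto>\<^bsub>?H\<^esub> B \<in> carrier ?H"
      by (rule imp_cl)
    show "\<sim>\<^bsub>?H\<^esub>B \<sqsubseteq>\<^bsub>?H\<^esub> \<sim>\<^bsub>?H\<^esub>A" if "A \<sqsubseteq>\<^bsub>?H\<^esub> B"
      using that by (auto simp: upset_algebra_sel neg)
    show "A \<sqinter>\<^bsub>?H\<^esub> \<sim>\<^bsub>?H\<^esub>A = \<bottom>\<^bsub>?H\<^esub>"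
      unfolding upset_algebra.meet_eq[OF car(1) neg_cl] upset_algebra.bot_eq
      unfolding neg using car by (auto simp: upset_algebra_sel)
    show "A \<sqsubseteq>\<^bsub>?H\<^esub> \<sim>\<^bsub>?H\<^esub>(\<sim>\<^bsub>?H\<^esub>A)"
      using car by (auto simp: upset_algebra_sel neg)
    have C: "C \<subseteq> W" "\<And>F G. \<lbrakk>F \<in> C; G \<in> W; F \<le> G\<rbrakk> \<Longrightarrow> G \<in> C"
      using car(3) by (auto simp: upset_algebra_sel)
    \<comment> \<open>From left to right, upward closure carries membership in \<open>C\<close> from
      \<open>F\<close> to \<open>G\<close>; from right to left, \<open>G\<close> is \<open>F\<close>
      itself.\<close>
    have "C \<inter> A \<subseteq> B \<longleftrightarrow> C \<subseteq> {F\<in>W. \<forall>G\<in>W. F \<le> G \<and> G \<in> A \<longrightarrow> G \<in> B}"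
      using C by (intro iffI subsetI) auto
    then show "C \<sqinter>\<^bsub>?H\<^esub> A \<sqsubseteq>\<^bsub>?H\<^esub> B \<longleftrightarrow> C \<sqsubseteq>\<^bsub>?H\<^esub> A \<leadsto>\<^bsub>?H\<^esub> B"
      by (simp only: upset_algebra.meet_eq[OF car(3,1)] upset_algebra_sel)
  qed
qed

section \<open>Prime filters\<close>

context bounded_lattice
begin

definition is_filter :: "'a set \<Rightarrow> bool" where
  "is_filter F \<longleftrightarrow> F \<subseteq> carrier L \<and> \<top> \<in> F \<and> (\<forall>x\<in>F. \<forall>y\<in>F. x \<sqinter> y \<in> F)
    \<and> (\<forall>x\<in>F. \<forall>y\<in>carrier L. x \<sqsubseteq> y \<longrightarrow> y \<in> F)"

text \<open>Excluding \<open>\<bottom>\<close> ensures that \<open>\<bottom>\<close> is represented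
  by the empty upset.\<close>

definition prime_filter :: "'a set \<Rightarrow> bool" where
  "prime_filter F \<longleftrightarrow> is_filter F \<and> \<bottom> \<notin> F
    \<and> (\<forall>x\<in>carrier L. \<forall>y\<in>carrier L. x \<squnion> y \<in> F \<longrightarrow> x \<in> F \<or> y \<in> F)"

lemma filterD:
  assumes "is_filter F"
  shows "x \<in> F \<Longrightarrow> x \<in> carrier L" "\<top> \<in> F" "x \<in> F \<Longrightarrow> y \<in> F \<Longrightarrow> x \<sqinter> y \<in> F"
    "x \<in> F \<Longrightarrow> x \<sqsubseteq> y \<Longrightarrow> y \<in> carrier L \<Longrightarrow> y \<in> F"
  using assms by (auto simp: is_filter_def)

lemma filter_meet_iff:
  assumes "is_filter F" "x \<in> carrier L" "y \<in> carrier L"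
  shows "x \<sqinter> y \<in> F \<longleftrightarrow> x \<in> F \<and> y \<in> F"
  using assms filterD(3,4)[OF assms(1)] meet_left[OF assms(2,3)] meet_right[OF assms(2,3)] by blast

text \<open>For a filter \<open>F\<close>, this is the filter generated by \<open>F\<close> and
  \<open>x\<close>.\<close>

definition adjoin :: "'a set \<Rightarrow> 'a \<Rightarrow> 'a set" where
  "adjoin F x = {y \<in> carrier L. \<exists>b\<in>F. b \<sqinter> x \<sqsubseteq> y}"

lemma filter_adjoin:
  assumes F: "is_filter F" and [simp]: "x \<in> carrier L"
  shows "is_filter (adjoin F x)" "F \<subseteq> adjoin F x" "x \<in> adjoin F x"
proof -
  note [simp] = filterD(1)[OF F]
  show "is_filter (adjoin F x)"
    unfolding is_filter_def
  proof (intro conjI ballI impI)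
    show "adjoin F x \<subseteq> carrier L" "\<top> \<in> adjoin F x"
      using filterD(2)[OF F] by (auto simp: adjoin_def)
  next
    fix y z assume "y \<in> adjoin F x" "z \<in> adjoin F x"
    then obtain b c where bc: "b \<in> F" "c \<in> F" "b \<sqinter> x \<sqsubseteq> y" "c \<sqinter> x \<sqsubseteq> z"
      and [simp]: "y \<in> carrier L" "z \<in> carrier L"
      by (auto simp: adjoin_def)
    then have [simp]: "b \<in> carrier L" "c \<in> carrier L"
      by auto
    have "b \<sqinter> c \<sqinter> x \<sqsubseteq> b \<sqinter> x" "b \<sqinter> c \<sqinter> x \<sqsubseteq> c \<sqinter> x"
      by (auto intro!: meet_le meet_right le_trans[OF meet_left meet_left]
          le_trans[OF meet_left meet_right])
    then have "b \<sqinter> c \<sqinter> x \<sqsubseteq> y \<sqinter> z"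
      using bc by (auto intro!: meet_le intro: le_trans)
    then show "y \<sqinter> z \<in> adjoin F x"
      using filterD(3)[OF F bc(1,2)] by (auto simp: adjoin_def)
  next
    fix y z assume "y \<in> adjoin F x" "z \<in> carrier L" "y \<sqsubseteq> z"
    moreover then obtain b where "b \<in> F" "b \<sqinter> x \<sqsubseteq> y" "y \<in> carrier L"
      by (auto simp: adjoin_def)
    ultimately show "z \<in> adjoin F x"
      using le_trans[of "b \<sqinter> x" y z] by (auto simp: adjoin_def)
  qed
  show "F \<subseteq> adjoin F x"
    by (auto simp: adjoin_def intro!: bexI meet_left)
  show "x \<in> adjoin F x"
    using filterD(2)[OF F] by (auto simp: adjoin_def intro!: bexI[of _ \<top>] meet_right)
qed

text \<open>Zorn's lemma, with maximality in the form used later: adjoining an outside element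
  produces a member of \<open>I\<close>. The set \<open>I\<close> is arbitrary and need not be an
  ideal.\<close>

lemma maximal_filter:
  assumes F: "is_filter F" "F \<inter> I = {}"
  obtains G where "is_filter G" "F \<subseteq> G" "G \<inter> I = {}"
    "\<And>x. x \<in> carrier L \<Longrightarrow> x \<notin> G \<Longrightarrow> \<exists>b\<in>G. \<exists>y\<in>I. b \<sqinter> x \<sqsubseteq> y"
proof -
  let ?A = "{G. is_filter G \<and> F \<subseteq> G \<and> G \<inter> I = {}}"
  have "\<exists>M\<in>?A. \<forall>X\<in>?A. M \<subseteq> X \<longrightarrow> X = M"
  proof (rule subset_Zorn_nonempty)
    show "?A \<noteq> {}"
      using F by auto
  next
    fix C assume C: "C \<noteq> {}" "subset.chain ?A C"
    then have fil: "is_filter G" "F \<subseteq> G" "G \<inter> I = {}" if "G \<in> C" for G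
      using that by (auto simp: subset_chain_def)
    have "x \<sqinter> y \<in> \<Union>C" if "x \<in> \<Union>C" "y \<in> \<Union>C" for x y
    proof -
      from that obtain G H where GH: "G \<in> C" "H \<in> C" "x \<in> G" "y \<in> H"
        by auto
      then have "G \<subseteq> H \<or> H \<subseteq> G"
        using C(2) by (auto simp: subset_chain_def)
      then show ?thesis
        using GH filterD(3)[OF fil(1)] by blast
    qed
    moreover have "\<Union>C \<subseteq> carrier L" "\<top> \<in> \<Union>C" "F \<subseteq> \<Union>C" "\<Union>C \<inter> I = {}"
      using C(1) fil filterD(1,2)[OF fil(1)] by blast+
    moreover have "y \<in> \<Union>C" if "x \<in> \<Union>C" "y \<in> carrier L" "x \<sqsubseteq> y" for x y
      using that filterD(4)[OF fil(1)] by blast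
    ultimately show "\<Union>C \<in> ?A"
      by (simp add: is_filter_def)
  qed
  then obtain G where G: "is_filter G" "F \<subseteq> G" "G \<inter> I = {}"
    and max: "\<And>X. \<lbrakk>is_filter X; F \<subseteq> X; X \<inter> I = {}; G \<subseteq> X\<rbrakk> \<Longrightarrow> X = G"
    by auto
  show thesis
  proof (rule that[OF G])
    fix x assume x: "x \<in> carrier L" "x \<notin> G"
    note adj = filter_adjoin[OF G(1) x(1)]
    have "adjoin G x \<noteq> G"
      using adj(3) x(2) by auto
    then have "adjoin G x \<inter> I \<noteq> {}"
      using max[OF adj(1) _ _ adj(2)] G(2) adj(2) by blast
    then show "\<exists>b\<in>G. \<exists>y\<in>I. b \<sqinter> x \<sqsubseteq> y"
      by (auto simp: adjoin_def)
  qed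
qed

end

section \<open>Existence of prime filters\<close>

context iEx_algebra
begin

text \<open>Take a filter maximal with \<open>p\<close> inside and everything below \<open>q\<close>
  outside. If it contained \<open>c \<squnion> e\<close> but neither \<open>c\<close> nor
  \<open>e\<close>, some member would have meets with \<open>c\<close> and with \<open>e\<close>
  both below \<open>q\<close>, and distributivity modulo \<open>q\<close> would force
  \<open>q\<close> into it.\<close>

lemma prime_filter_separation:
  assumes [simp]: "p \<in> carrier L" "q \<in> carrier L" and pq: "\<not> p \<sqsubseteq> q" "p \<sqsubseteq> \<sim>\<sim>q"
  obtains G where "prime_filter G" "p \<in> G" "q \<notin> G"
proof -
  let ?I = "{y \<in> carrier L. y \<sqsubseteq> q}" and ?F = "{y \<in> carrier L. p \<sqsubseteq> y}"
  have "is_filter ?F"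
    by (auto simp: is_filter_def intro: meet_le le_trans)
  moreover have "?F \<inter> ?I = {}"
    using pq(1) le_trans[of p _ q] by auto
  ultimately obtain G where G: "is_filter G" "?F \<subseteq> G" "G \<inter> ?I = {}"
    and max: "\<And>x. x \<in> carrier L \<Longrightarrow> x \<notin> G \<Longrightarrow> \<exists>b\<in>G. \<exists>y\<in>?I. b \<sqinter> x \<sqsubseteq> y"
    by (rule maximal_filter) blast
  note [simp] = filterD(1)[OF G(1)]
  have "prime_filter G"
    unfolding prime_filter_def
  proof (intro conjI ballI impI)
    show "is_filter G" by fact
    show "\<bottom> \<notin> G" using G(3) by auto
    fix c e assume [simp]: "c \<in> carrier L" "e \<in> carrier L" and ce: "c \<squnion> e \<in> G"
    show "c \<in> G \<or> e \<in> G"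
    proof (rule ccontr)
      assume "\<not> (c \<in> G \<or> e \<in> G)"
      with max[of c] max[of e] obtain a b y z where ab: "a \<in> G" "b \<in> G" "a \<sqinter> c \<sqsubseteq> y" "b \<sqinter> e \<sqsubseteq> z"
        and yz: "y \<in> ?I" "z \<in> ?I"
        by auto
      then have [simp]: "a \<in> carrier L" "b \<in> carrier L"
        by simp_all
      let ?a = "a \<sqinter> b"
      have "a \<sqinter> c \<sqsubseteq> q" "b \<sqinter> e \<sqsubseteq> q"
        using ab(3,4) yz le_trans[of "a \<sqinter> c" y q] le_trans[of "b \<sqinter> e" z q] by auto
      moreover have "?a \<sqinter> c \<sqsubseteq> a \<sqinter> c" "?a \<sqinter> e \<sqsubseteq> b \<sqinter> e"
        by (intro meet_le; simp add: meet3_le)+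
      ultimately have "?a \<sqinter> c \<sqsubseteq> q" "?a \<sqinter> e \<sqsubseteq> q"
        using le_trans[of "?a \<sqinter> c" "a \<sqinter> c" q] le_trans[of "?a \<sqinter> e" "b \<sqinter> e" q] by auto
      then have "(?a \<sqinter> c) \<squnion> (?a \<sqinter> e) \<squnion> q \<sqsubseteq> q"
        by (simp add: join_le)
      with distrib_below_neg_neg[of ?a c e q] have "?a \<sqinter> (c \<squnion> e) \<sqinter> \<sim>\<sim>q \<sqsubseteq> q"
        using le_trans[of "?a \<sqinter> (c \<squnion> e) \<sqinter> \<sim>\<sim>q" "(?a \<sqinter> c) \<squnion> (?a \<sqinter> e) \<squnion> q" q] by simp
      \<comment> \<open>Here \<open>p \<sqsubseteq> \<sim>\<sim>q\<close> enters: it places the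
        filter where distributivity modulo \<open>q\<close> is available.\<close>
      moreover have "\<sim>\<sim>q \<in> G"
        using G(2) pq(2) by auto
      then have "?a \<sqinter> (c \<squnion> e) \<sqinter> \<sim>\<sim>q \<in> G"
        using ab(1,2) ce by (intro filterD(3)[OF G(1)])
      ultimately have "q \<in> G"
        using filterD(4)[OF G(1)] by simp
      with G(3) show False by auto
    qed
  qed
  moreover have "p \<in> G" "q \<notin> G"
    using G by auto
  ultimately show thesis by (rule that)
qed

text \<open>This supplies the larger world that refutes an implication. If \<open>x \<in> F\<close>,
  then \<open>F\<close> itself serves, as
  \<open>x \<sqinter> g = x \<sqinter> (x \<leadsto> g)\<close>. Otherwise \<open>G\<close> is a
  maximal extension of \<open>F\<close> and \<open>x\<close> that avoids every \<open>y\<close> with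
  \<open>y \<leadsto> g \<in> F\<close>.\<close>

lemma prime_filter_imp:
  assumes F: "prime_filter F" and [simp]: "x \<in> carrier L" "g \<in> carrier L" and nimp: "x \<leadsto> g \<notin> F"
  obtains G where "prime_filter G" "F \<subseteq> G" "x \<in> G" "g \<notin> G"
proof (cases "x \<in> F")
  case True
  have fil: "is_filter F"
    using F by (simp add: prime_filter_def)
  have "g \<notin> F"
  proof
    assume "g \<in> F"
    with True have "x \<sqinter> (x \<leadsto> g) \<in> F"
      by (simp add: meet_imp filterD(3)[OF fil])
    then show False
      using nimp by (simp add: filter_meet_iff[OF fil])
  qed
  with F True show thesis
    using that by blast
next
  case False
  have fil: "is_filter F"
    and F_prime: "\<And>a b. \<lbrakk>a \<in> carrier L; b \<in> carrier L; a \<squnion> b \<in> F\<rbrakk> \<Longrightarrow> a \<in> F \<or> b \<in> F"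
    using F by (auto simp: prime_filter_def)
  note [simp] = filterD(1)[OF fil]
  \<comment> \<open>A filter that is merely maximal without \<open>g\<close> need not be prime. Enlarging the set to be avoided
    makes the third conjunct of iEx applicable at elements of the filter outside \<open>F\<close>.\<close>
  let ?I = "{y \<in> carrier L. y \<leadsto> g \<in> F}"
  \<comment> \<open>The implication in \<open>imp_disj\<close> becomes \<open>\<top>\<close> by the
    last assumption, so \<open>a \<in> F\<close> puts a disjunction into the prime filter
    \<open>F\<close> although neither disjunct is there.\<close>
  have key: False
    if [simp]: "a \<in> carrier L" "b \<in> carrier L" "c \<in> carrier L" "d \<in> carrier L"
      and Q: "b \<sqinter> (c \<squnion> d) \<notin> F" "b \<sqinter> (c \<squnion> d) \<leadsto> g \<notin> F"
      and a: "a \<in> F" "a \<sqinter> ((b \<sqinter> c) \<squnion> (b \<sqinter> d)) \<sqsubseteq> g" for a b c d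
  proof -
    have "((a \<sqinter> ((b \<sqinter> c) \<squnion> (b \<sqinter> d))) \<leadsto> g) \<sqinter> a \<in> F"
      using a by (simp add: le_imp_top filterD(2,3)[OF fil])
    then have "(b \<sqinter> (c \<squnion> d)) \<squnion> ((b \<sqinter> (c \<squnion> d)) \<leadsto> g) \<in> F"
      by (rule filterD(4)[OF fil _ imp_disj]) simp_all
    with Q F_prime[of "b \<sqinter> (c \<squnion> d)" "b \<sqinter> (c \<squnion> d) \<leadsto> g"] show False
      by simp
  qed
  have "adjoin F x \<inter> ?I = {}"
  proof -
    have False if z: "z \<in> carrier L" "z \<leadsto> g \<in> F" and a: "a \<in> F" "a \<sqinter> x \<sqsubseteq> z" for a z
    proof -
      note [simp] = z(1) filterD(1)[OF fil a(1)]
      \<comment> \<open>For \<open>x\<close>, \<open>\<top>\<close>, \<open>\<top>\<close> in place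
        of \<open>b\<close>, \<open>c\<close>, \<open>d\<close>, \<open>key\<close> says that no
        member of \<open>F\<close> has a meet with \<open>x\<close> below \<open>g\<close>. The
        element \<open>?a\<close> would be such a member.\<close>
      let ?a = "a \<sqinter> (z \<leadsto> g)"
      have xx: "x \<sqinter> (\<top> \<squnion> \<top>) = x"
        by (intro le_antisym meet_le) (auto intro: meet_left le_join_left)
      have "?a \<sqinter> ((x \<sqinter> \<top>) \<squnion> (x \<sqinter> \<top>)) \<sqsubseteq> ?a \<sqinter> x"
        by (rule meet_le[OF meet_left]) (simp_all add: meet_left meet_le_right join_le)
      also have "\<dots> \<sqsubseteq> a \<sqinter> x \<sqinter> (z \<leadsto> g)"
        by (intro meet_le) (simp_all add: meet3_le)
      also have "\<dots> \<sqsubseteq> z \<sqinter> (z \<leadsto> g)"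
        using a(2) by (intro meet_le) (auto intro: meet_le_left meet_right)
      also have "\<dots> \<sqsubseteq> g"
        by (simp add: meet_imp meet_right)
      finally show False
        using key[of ?a x \<top> \<top>] xx False nimp a z by (simp add: filterD(3)[OF fil])
    qed
    then show ?thesis
      by (auto simp: adjoin_def)
  qed
  with filter_adjoin(1)[OF fil \<open>x \<in> carrier L\<close>]
  obtain G where G: "is_filter G" "adjoin F x \<subseteq> G" "G \<inter> ?I = {}"
    and max: "\<And>x. x \<in> carrier L \<Longrightarrow> x \<notin> G \<Longrightarrow> \<exists>b\<in>G. \<exists>y\<in>?I. b \<sqinter> x \<sqsubseteq> y"
    by (rule maximal_filter) blast
  have FG: "F \<subseteq> G" and xG: "x \<in> G"
    using G(2) filter_adjoin(2,3)[OF fil \<open>x \<in> carrier L\<close>] by auto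
  have "prime_filter G"
    unfolding prime_filter_def
  proof (intro conjI ballI impI)
    show "is_filter G" by fact
    show "\<bottom> \<notin> G" using G(3) by (auto simp: le_imp_top filterD(2)[OF fil])
    fix c e assume [simp]: "c \<in> carrier L" "e \<in> carrier L" and ce: "c \<squnion> e \<in> G"
    show "c \<in> G \<or> e \<in> G"
    proof (rule ccontr)
      assume "\<not> (c \<in> G \<or> e \<in> G)"
      with max[of c] max[of e] obtain a b y z where ab: "a \<in> G" "b \<in> G" "a \<sqinter> c \<sqsubseteq> y" "b \<sqinter> e \<sqsubseteq> z"
        and yz: "y \<in> ?I" "z \<in> ?I"
        by auto
      then have [simp]: "a \<in> carrier L" "b \<in> carrier L" "y \<in> carrier L" "z \<in> carrier L"
        by (simp_all add: filterD(1)[OF G(1)])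
      \<comment> \<open>Both implications are in \<open>F\<close> because \<open>y\<close> and
        \<open>z\<close> are in \<open>?I\<close>; they carry \<open>?b \<sqinter> c\<close> and
        \<open>?b \<sqinter> e\<close> on to \<open>g\<close>. The factor \<open>x\<close> of
        \<open>?b\<close> keeps \<open>?Q\<close> out of \<open>F\<close>.\<close>
      let ?h = "(y \<leadsto> g) \<sqinter> (z \<leadsto> g)"
      let ?b = "a \<sqinter> b \<sqinter> x \<sqinter> ?h"
      let ?Q = "?b \<sqinter> (c \<squnion> e)"
      have B: "?b \<sqsubseteq> a" "?b \<sqsubseteq> b" "?b \<sqsubseteq> x" "?b \<sqsubseteq> ?h"
        by (simp_all add: meet4_le)
      have "?b \<sqsubseteq> y \<leadsto> g" "?b \<sqsubseteq> z \<leadsto> g"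
        by (rule le_trans[OF B(4)]; simp add: meet_left meet_right)+
      then have imps: "?b \<sqinter> c \<sqsubseteq> y \<leadsto> g" "?b \<sqinter> e \<sqsubseteq> z \<leadsto> g"
        by (simp_all add: meet_le_left)
      have "?b \<sqinter> c \<sqsubseteq> a \<sqinter> c" "?b \<sqinter> e \<sqsubseteq> b \<sqinter> e"
        using B by (simp_all add: meet_le meet_le_left meet_right)
      then have "?b \<sqinter> c \<sqsubseteq> y" "?b \<sqinter> e \<sqsubseteq> z"
        using ab(3,4) le_trans[of "?b \<sqinter> c" "a \<sqinter> c" y] le_trans[of "?b \<sqinter> e" "b \<sqinter> e" z] by auto
      moreover have "w \<sqsubseteq> g" if "w \<sqsubseteq> u" "w \<sqsubseteq> u \<leadsto> g" "u \<in> carrier L" "w \<in> carrier L" for u w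
        using that meet_le[of w u "u \<leadsto> g"] le_trans[of w "u \<sqinter> g" g]
        by (simp add: meet_imp meet_right)
      ultimately have "(?b \<sqinter> c) \<squnion> (?b \<sqinter> e) \<sqsubseteq> g"
        using imps by (simp add: join_le)
      \<comment> \<open>The witnesses \<open>a\<close> and \<open>b\<close> lie in \<open>G\<close>,
        possibly outside \<open>F\<close>, so they are absorbed into the second argument of
        \<open>key\<close>, and its first argument is just \<open>\<top>\<close>.\<close>
      then have "\<top> \<sqinter> ((?b \<sqinter> c) \<squnion> (?b \<sqinter> e)) \<sqsubseteq> g"
        by (simp add: meet_le_right)
      moreover have "?Q \<in> G"
        using ab(1,2) xG ce yz FG by (auto intro!: filterD(3)[OF G(1)] simp: filterD(3)[OF fil])
      then have "?Q \<leadsto> g \<notin> F"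
        using G(3) filterD(1)[OF G(1)] by blast
      moreover have "?Q \<notin> F"
        using False by (auto simp: filter_meet_iff[OF fil])
      ultimately show False
        using key[of \<top> ?b c e] filterD(2)[OF fil] by simp
    qed
  qed
  moreover have "g \<notin> G"
    using G(3) by (auto simp: le_imp_top filterD(2)[OF fil])
  ultimately show thesis
    using FG xG by (intro that)
qed

section \<open>Representation by upsets of prime filters\<close>

text \<open>The Stone map. By \<open>prime_filter_separation\<close> it detects a failure of
  \<open>p \<sqsubseteq> q\<close> whenever \<open>p \<sqsubseteq> \<sim>\<sim>q\<close>.\<close>

definition prime_filters_of :: "'a \<Rightarrow> 'a set set" where
  "prime_filters_of a = {F. prime_filter F \<and> a \<in> F}"

abbreviation "H \<equiv> upset_algebra (Collect prime_filter)"

lemma prime_filters_of_closed: "prime_filters_of a \<in> carrier H"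
  by (auto simp: prime_filters_of_def upset_algebra_sel)

text \<open>Meets need only filters and joins use primeness. For implication,
  \<open>meet_imp\<close> gives modus ponens inside each larger filter, and
  \<open>prime_filter_imp\<close> gives the converse.\<close>

lemma prime_filters_of_hom:
  assumes [simp]: "a \<in> carrier L" "b \<in> carrier L"
  shows "prime_filters_of (a \<sqinter> b) = prime_filters_of a \<inter> prime_filters_of b"
    and "prime_filters_of (a \<squnion> b) = prime_filters_of a \<union> prime_filters_of b"
    and "prime_filters_of (a \<leadsto> b) = prime_filters_of a \<leadsto>\<^bsub>H\<^esub> prime_filters_of b"
proof -
  show "prime_filters_of (a \<sqinter> b) = prime_filters_of a \<inter> prime_filters_of b"
    by (auto simp: prime_filters_of_def prime_filter_def filter_meet_iff)
  show "prime_filters_of (a \<squnion> b) = prime_filters_of a \<union> prime_filters_of b"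
  proof (intro equalityI subsetI)
    fix F assume F: "F \<in> prime_filters_of a \<union> prime_filters_of b"
    then have "is_filter F"
      by (auto simp: prime_filters_of_def prime_filter_def)
    then have "a \<squnion> b \<in> F"
      using F filterD(4)[of F a "a \<squnion> b"] filterD(4)[of F b "a \<squnion> b"]
      by (auto simp: prime_filters_of_def join_left join_right)
    with F show "F \<in> prime_filters_of (a \<squnion> b)"
      by (auto simp: prime_filters_of_def)
  qed (auto simp: prime_filters_of_def prime_filter_def)
  have mp: "b \<in> F" if "prime_filter F" "a \<leadsto> b \<in> F" "a \<in> F" for F
  proof -
    have F: "is_filter F"
      using that(1) by (simp add: prime_filter_def)
    from that(2,3) have "a \<sqinter> (a \<leadsto> b) \<in> F"
      by (simp add: filterD(3)[OF F])
    then show ?thesis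
      by (simp add: meet_imp filter_meet_iff[OF F])
  qed
  show "prime_filters_of (a \<leadsto> b) = prime_filters_of a \<leadsto>\<^bsub>H\<^esub> prime_filters_of b"
  proof (intro equalityI subsetI)
    fix F assume "F \<in> prime_filters_of (a \<leadsto> b)"
    then show "F \<in> prime_filters_of a \<leadsto>\<^bsub>H\<^esub> prime_filters_of b"
      using mp by (auto simp: prime_filters_of_def upset_algebra_sel)
  next
    fix F assume F: "F \<in> prime_filters_of a \<leadsto>\<^bsub>H\<^esub> prime_filters_of b"
    then have pF: "prime_filter F"
      by (simp add: upset_algebra_sel)
    have "a \<leadsto> b \<in> F"
    proof (rule ccontr)
      assume "a \<leadsto> b \<notin> F"
      with pF obtain G where "prime_filter G" "F \<subseteq> G" "a \<in> G" "b \<notin> G"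
        using prime_filter_imp[of F a b] by auto
      with F show False
        by (auto simp: prime_filters_of_def upset_algebra_sel)
    qed
    with pF show "F \<in> prime_filters_of (a \<leadsto> b)"
      by (simp add: prime_filters_of_def)
  qed
qed

lemma eval_upset:
  "(\<And>p. v p \<in> carrier L) \<Longrightarrow> eval H (\<lambda>p. prime_filters_of (v p)) \<chi> = prime_filters_of (eval L v \<chi>)"
proof (induction \<chi>)
  case Zero
  show ?case
    by (auto simp: upset_algebra.bot_eq prime_filters_of_def prime_filter_def)
next
  case One
  show ?case
    by (auto simp: upset_algebra.top_eq' prime_filters_of_def prime_filter_def filterD(2))
qed (auto simp: upset_algebra.meet_eq upset_algebra.join_eq prime_filters_of_closed
    prime_filters_of_hom eval_closed)

text \<open>The two validities complement each other: the one in \<open>R\<close> yields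
  \<open>?p \<sqsubseteq> \<sim>\<sim>?q\<close>, the hypothesis under which a counterexample to
  \<open>?p \<sqsubseteq> ?q\<close> would be visible in \<open>H\<close>.\<close>

lemma valid_in_if_regular_and_upset:
  fixes \<phi> \<psi> :: "'v form"
  assumes reg: "valid_in R \<phi> \<psi>" and up: "valid_in H \<phi> \<psi>"
  shows "valid_in L \<phi> \<psi>"
  unfolding valid_in_def
proof
  fix v :: "'v \<Rightarrow> 'a" assume "v \<in> UNIV \<rightarrow> carrier L"
  then have v: "v p \<in> carrier L" for p
    by auto
  let ?p = "eval L v \<phi>" and ?q = "eval L v \<psi>"
  have [simp]: "?p \<in> carrier L" "?q \<in> carrier L"
    by (simp_all add: eval_closed v)
  have "(\<lambda>p. \<sim>\<sim>v p) \<in> UNIV \<rightarrow> carrier R"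
    by (auto simp: R_sel v neg_neg_neg)
  with reg have "eval R (\<lambda>p. \<sim>\<sim>v p) \<phi> \<sqsubseteq>\<^bsub>R\<^esub> eval R (\<lambda>p. \<sim>\<sim>v p) \<psi>"
    unfolding valid_in_def by (rule bspec)
  then have "\<sim>\<sim>?p \<sqsubseteq> \<sim>\<sim>?q"
    by (simp only: eval_regular v R_sel(2))
  then have pq: "?p \<sqsubseteq> \<sim>\<sim>?q"
    using le_trans[of ?p "\<sim>\<sim>?p" "\<sim>\<sim>?q"] by (simp add: le_neg_neg)
  have "(\<lambda>p. prime_filters_of (v p)) \<in> UNIV \<rightarrow> carrier H"
    by (auto simp: prime_filters_of_closed)
  with up have "eval H (\<lambda>p. prime_filters_of (v p)) \<phi> \<sqsubseteq>\<^bsub>H\<^esub> eval H (\<lambda>p. prime_filters_of (v p)) \<psi>"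
    unfolding valid_in_def by (rule bspec)
  then have "prime_filters_of ?p \<subseteq> prime_filters_of ?q"
    by (simp only: eval_upset v upset_algebra_sel(2))
  then have "\<And>G. \<lbrakk>prime_filter G; ?p \<in> G\<rbrakk> \<Longrightarrow> ?q \<in> G"
    by (auto simp: prime_filters_of_def)
  then show "?p \<sqsubseteq> ?q"
    using prime_filter_separation[of ?p ?q] pq \<open>?p \<in> carrier L\<close> \<open>?q \<in> carrier L\<close> by metis
qed

end

section \<open>Coincidence of the joint validities with the axiomatized ones\<close>

theorem theorem1p1:
  fixes \<phi> \<psi> :: "'v form"
  shows "heyting_valid TYPE('a::infinite) \<phi> \<psi> \<and> orthomodular_valid TYPE('b::infinite) \<phi> \<psi>
    \<longleftrightarrow> iEx_valid TYPE('c::infinite) \<phi> \<psi>"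
proof (intro iffI conjI)
  assume "heyting_valid TYPE('a) \<phi> \<psi> \<and> orthomodular_valid TYPE('b) \<phi> \<psi>"
  \<comment> \<open>For an algebra over \<open>'c\<close>, the elements of \<open>R\<close> have
    type \<open>'c\<close> and those of \<open>H\<close> type \<open>'c set set\<close>;
    \<open>orthomodular_valid_in\<close> and \<open>heyting_valid_in\<close> bring validity from
    \<open>'b\<close> and \<open>'a\<close> to these types.\<close>
  then show "iEx_valid TYPE('c) \<phi> \<psi>"
    unfolding iEx_valid_def
    by (blast intro: iEx_algebra.valid_in_if_regular_and_upset heyting_valid_in
        orthomodular_valid_in heyting_upset_algebra iEx_algebra.regular_orthomodular)
next
  assume "iEx_valid TYPE('c) \<phi> \<psi>"
  then show "heyting_valid TYPE('a) \<phi> \<psi>" "orthomodular_valid TYPE('b) \<phi> \<psi>"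
    unfolding heyting_valid_def orthomodular_valid_def
    by (blast intro: iEx_valid_in heyting_algebra.iEx_algebra orthomodular_algebra.iEx_algebra)+
qed

end
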